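(* Let $\Gamma_1$ and $\Gamma_2$ be locally finite connected graphs, $(X_i,d_i)$ the set of vertices of $\Gamma_i$ with its induced metric, $f_1,f_2$ Floyd maps, and $\pi: X_2\to X_1$ an $\alpha$-quasi-isometry, where $\alpha:\mathbb N\to\mathbb N$ is a distortion map such that there is $D>0$ with $$\frac{f_2(n)}{f_1(\alpha(n))}\leqslant D\quad\text{and}\quad \frac{f_1(n)}{f_2(\alpha(n))}\leqslant D\qquad\text{for all } n\in\mathbb N.$$ Then the functor $\Pi$ induced by $\pi$ sends the Floyd compactification $X_1+_{\partial_{f_1}}\partial_{f_1}(X_1)$ of $X_1$ with respect to $f_1$ to a space that is isomorphic (by a homeomorphism that is the identity on $X_2$) to the Floyd compactification $X_2+_{\partial_{f_2}}\partial_{f_2}(X_2)$ of $X_2$ with respect to $f_2$.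
   Context: Glueings. $Closed(X)$ is the set of closed subsets of $X$. A map $f:Closed(X)\to Closed(W)$ is admissible if $f(\emptyset)=\emptyset$ and $f(A\cup B)=f(A)\cup f(B)$; $X+_fW$ is the disjoint union $X\dot\cup W$ in which $C$ is closed iff $C\cap X$ is closed in $X$, $C\cap W$ is closed in $W$ and $f(C\cap X)\subseteq C$. Every space that is the disjoint union of an open subspace $X$ and its complement $W$ is uniquely of this form, with $f(A)=Cl(A)-X$. The functor $\Pi$ induced by $\pi: X_2\to X_1$ sends a compactification $X_1+_fW$ to $X_2+_{f^*}W$, where $f^*(A)=f(Cl_{X_1}(\pi(A)))$ (here $X_1,X_2$ are discrete). A Floyd map is $f:\mathbb N\to\mathbb R_{>0}$ such that there is $k>0$ with $1\leqslant f(n)/f(n+1)\leqslant k$ for all $n$, and $\sum_n f(n)<\infty$. For a locally finite connected graph with vertex set $(X,d)$ and $v\in X$, let $\delta_v(x,y)$ be the infimum of $\sum_{i=1}^{m-1} f(d(v,\{x_i,x_{i+1}\}))$ over paths $x=x_1,\dots,x_m=y$ of vertices (consecutive vertices adjacent). The Floyd compactification $X+_{\partial_f}\partial_f(X)$ is the Cauchy completion of $(X,\delta_v)$; as a topological space it does not depend on $v$. A distortion map is a nondecreasing $\alpha:\mathbb N\to\mathbb N$ with $\alpha(n)\to\infty$. A map $\pi:(X_2,d_2)\to(X_1,d_1)$ is $\alpha$-quasi-isometric if $d_1(\pi(x),\pi(y))\leqslant\alpha(d_2(x,y))$ and $d_2(x,y)\leqslant\alpha(d_1(\pi(x),\pi(y)))$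 for all $x,y$. It is an $\alpha$-quasi-isometry if it is $\alpha$-quasi-isometric and has a quasi-inverse $\varpi:X_1\to X_2$ (i.e. $\sup_x d_2(\varpi\pi(x),x)<\infty$ and $\sup_y d_1(\pi\varpi(y),y)<\infty$) that is also $\alpha$-quasi-isometric. *)

theory Defs
  imports "HOL-Analysis.Analysis"
begin

section \<open>Glueings\<close>

text \<open>\<open>f : Closed(X) \<rightarrow> Closed(W)\<close> is rendered as a function on all sets of which only the values on
  closed sets matter.\<close>

definition admissible_map :: "'a topology \<Rightarrow> 'b topology \<Rightarrow> ('a set \<Rightarrow> 'b set) \<Rightarrow> bool" where
  "admissible_map X W f \<longleftrightarrow>
     (\<forall>A. closedin X A \<longrightarrow> closedin W (f A)) \<and> f {} = {} \<and>
     (\<forall>A B. closedin X A \<and> closedin X B \<longrightarrow> f (A \<union> B) = f A \<union> f B)"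

definition glueing_closed :: "'a topology \<Rightarrow> 'b topology \<Rightarrow> ('a set \<Rightarrow> 'b set) \<Rightarrow> ('a + 'b) set \<Rightarrow> bool" where
  "glueing_closed X W f C \<longleftrightarrow>
     C \<subseteq> topspace X <+> topspace W \<and> closedin X (Inl -` C) \<and> closedin W (Inr -` C) \<and>
     f (Inl -` C) \<subseteq> Inr -` C"

text \<open>The space \<open>X +\<^sub>f W\<close>; see \<open>closedin_glueing\<close> below.\<close>

definition glueing :: "'a topology \<Rightarrow> 'b topology \<Rightarrow> ('a set \<Rightarrow> 'b set) \<Rightarrow> ('a + 'b) topology" where
  "glueing X W f = topology (\<lambda>U. U \<subseteq> topspace X <+> topspace W \<and>
     glueing_closed X W f ((topspace X <+> topspace W) - U))"

text \<open>A space \<open>T\<close> containing \<open>X\<close> as an open subspace, via the embedding \<open>\<iota>\<close>, is \<open>X +\<^sub>f W\<close> with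
  \<open>W = remainder X T \<iota>\<close>, the complement of \<open>X\<close>, and \<open>f = remainder_map X T \<iota>\<close>; see \<open>homeomorphic_map_glueing_remainder\<close>.\<close>

definition remainder :: "'a topology \<Rightarrow> 'b topology \<Rightarrow> ('a \<Rightarrow> 'b) \<Rightarrow> 'b topology" where
  "remainder X T \<iota> = subtopology T (topspace T - \<iota> ` topspace X)"

definition remainder_map :: "'a topology \<Rightarrow> 'b topology \<Rightarrow> ('a \<Rightarrow> 'b) \<Rightarrow> 'a set \<Rightarrow> 'b set" where
  "remainder_map X T \<iota> A = T closure_of (\<iota> ` A) - \<iota> ` topspace X"

definition pullback_map :: "'a topology \<Rightarrow> ('b \<Rightarrow> 'a) \<Rightarrow> ('a set \<Rightarrow> 'c set) \<Rightarrow> 'b set \<Rightarrow> 'c set" where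
  "pullback_map X1 \<pi> f A = f (X1 closure_of (\<pi> ` A))"

text \<open>The action on objects of the functor \<open>\<Pi>\<close> induced by \<open>\<pi> : X2 \<rightarrow> X1\<close>: the space
  \<open>T = X1 +\<^sub>f W\<close> (with \<open>\<iota> : X1 \<rightarrow> T\<close> the inclusion) is sent to \<open>X2 +\<^bsub>f*\<^esub> W\<close>.\<close>

definition Pi_functor ::
  "'a topology \<Rightarrow> 'b topology \<Rightarrow> ('b \<Rightarrow> 'a) \<Rightarrow> 'c topology \<Rightarrow> ('a \<Rightarrow> 'c) \<Rightarrow> ('b + 'c) topology" where
  "Pi_functor X1 X2 \<pi> T \<iota> =
     glueing X2 (remainder X1 T \<iota>) (pullback_map X1 \<pi> (remainder_map X1 T \<iota>))"

lemma glueing_closed_Int_Union: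
  assumes f: "admissible_map X W f"
  shows "glueing_closed X W f C \<Longrightarrow> glueing_closed X W f D \<Longrightarrow> glueing_closed X W f (C \<union> D)"
    and "\<K> \<noteq> {} \<Longrightarrow> (\<And>C. C \<in> \<K> \<Longrightarrow> glueing_closed X W f C) \<Longrightarrow> glueing_closed X W f (\<Inter>\<K>)"
proof -
  have mono: "f A \<subseteq> f B" if "closedin X A" "closedin X B" "A \<subseteq> B" for A B
    using f that unfolding admissible_map_def by (metis Un_absorb1 Un_upper1)
  show "glueing_closed X W f (C \<union> D)" if "glueing_closed X W f C" "glueing_closed X W f D"
    using that f unfolding glueing_closed_def admissible_map_def vimage_Un by auto
  assume ne: "\<K> \<noteq> {}" and K: "\<And>C. C \<in> \<K> \<Longrightarrow> glueing_closed X W f C"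
  have l: "Inl -` \<Inter>\<K> = \<Inter>((vimage Inl) ` \<K>)" and r: "Inr -` \<Inter>\<K> = \<Inter>((vimage Inr) ` \<K>)" by auto
  have cl: "closedin X (Inl -` \<Inter>\<K>)"
    unfolding l using K ne by (intro closedin_Inter) (auto simp: glueing_closed_def)
  have cr: "closedin W (Inr -` \<Inter>\<K>)"
    unfolding r using K ne by (intro closedin_Inter) (auto simp: glueing_closed_def)
  have "f (Inl -` \<Inter>\<K>) \<subseteq> Inr -` C" if "C \<in> \<K>" for C
  proof -
    have "f (Inl -` \<Inter>\<K>) \<subseteq> f (Inl -` C)"
      using K[OF that] that by (intro mono cl) (auto simp: glueing_closed_def)
    then show ?thesis using K[OF that] by (auto simp: glueing_closed_def)
  qed
  then show "glueing_closed X W f (\<Inter>\<K>)"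
    using cl cr ne K unfolding glueing_closed_def by blast
qed

lemma istopology_glueing:
  assumes f: "admissible_map X W f"
  shows "istopology (\<lambda>U. U \<subseteq> topspace X <+> topspace W \<and>
           glueing_closed X W f ((topspace X <+> topspace W) - U))"
proof -
  let ?S = "topspace X <+> topspace W"
  show ?thesis
    unfolding istopology_def
  proof (intro conjI allI impI)
    fix U V assume "U \<subseteq> ?S \<and> glueing_closed X W f (?S - U)" "V \<subseteq> ?S \<and> glueing_closed X W f (?S - V)"
    then show "U \<inter> V \<subseteq> ?S" "glueing_closed X W f (?S - U \<inter> V)"
      using glueing_closed_Int_Union(1)[OF f] by (auto simp: Diff_Int)
  next
    fix \<K> assume K: "\<forall>K\<in>\<K>. K \<subseteq> ?S \<and> glueing_closed X W f (?S - K)"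
    then show "\<Union>\<K> \<subseteq> ?S" by blast
    show "glueing_closed X W f (?S - \<Union>\<K>)"
    proof (cases "\<K> = {}")
      case True
      have "Inl -` ?S = topspace X" "Inr -` ?S = topspace W" by auto
      moreover have "f (topspace X) \<subseteq> topspace W"
        using f closedin_subset unfolding admissible_map_def by blast
      ultimately show ?thesis using True by (simp add: glueing_closed_def)
    next
      case False
      then have "glueing_closed X W f (\<Inter>K\<in>\<K>. ?S - K)"
        using K by (intro glueing_closed_Int_Union(2)[OF f]) auto
      moreover have "?S - \<Union>\<K> = (\<Inter>K\<in>\<K>. ?S - K)" using False by blast
      ultimately show ?thesis by simp
    qed
  qed
qed

lemma topspace_glueing:
  assumes f: "admissible_map X W f"
  shows "topspace (glueing X W f) = topspace X <+> topspace W"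
proof -
  have o: "openin (glueing X W f) = (\<lambda>U. U \<subseteq> topspace X <+> topspace W \<and>
           glueing_closed X W f ((topspace X <+> topspace W) - U))"
    unfolding glueing_def by (rule topology_inverse'[OF istopology_glueing[OF f]])
  have "glueing_closed X W f {}"
    using f by (auto simp: glueing_closed_def admissible_map_def)
  then have "openin (glueing X W f) (topspace X <+> topspace W)" by (simp add: o)
  moreover have "topspace (glueing X W f) \<subseteq> topspace X <+> topspace W"
    using openin_topspace[of "glueing X W f"] unfolding o by blast
  ultimately show ?thesis using openin_subset by blast
qed

lemma closedin_glueing:
  assumes f: "admissible_map X W f"
  shows "closedin (glueing X W f) C \<longleftrightarrow>
     C \<subseteq> topspace X <+> topspace W \<and> closedin X (Inl -` C) \<and> closedin W (Inr -` C) \<and>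
     f (Inl -` C) \<subseteq> Inr -` C"
proof -
  let ?S = "topspace X <+> topspace W"
  have o: "openin (glueing X W f) = (\<lambda>U. U \<subseteq> ?S \<and> glueing_closed X W f (?S - U))"
    unfolding glueing_def by (rule topology_inverse'[OF istopology_glueing[OF f]])
  have "?S - (?S - C) = C" if "C \<subseteq> ?S" using that by blast
  then have "closedin (glueing X W f) C \<longleftrightarrow> glueing_closed X W f C"
    unfolding closedin_def topspace_glueing[OF f] o by (auto simp: glueing_closed_def)
  then show ?thesis by (simp add: glueing_closed_def)
qed

lemma admissible_remainder_map:
  assumes "openin T (\<iota> ` topspace X)"
  shows "admissible_map X (remainder X T \<iota>) (remainder_map X T \<iota>)"
  unfolding admissible_map_def
proof (intro conjI allI impI)
  fix A
  show "closedin (remainder X T \<iota>) (remainder_map X T \<iota> A)"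
    unfolding remainder_def remainder_map_def closedin_subtopology
    using closure_of_subset_topspace[of T "\<iota> ` A"]
    by (intro exI[of _ "T closure_of (\<iota> ` A)"]) auto
qed (auto simp: remainder_map_def image_Un)

lemma admissible_pullback_map:
  assumes "admissible_map X1 W f"
  shows "admissible_map X2 W (pullback_map X1 \<pi> f)"
  using assms by (auto simp: admissible_map_def pullback_map_def image_Un)

lemma homeomorphic_map_glueing_remainder:
  assumes \<iota>: "embedding_map X T \<iota>" and op: "openin T (\<iota> ` topspace X)"
  shows "homeomorphic_map (glueing X (remainder X T \<iota>) (remainder_map X T \<iota>)) T (case_sum \<iota> id)"
proof -
  let ?W = "remainder X T \<iota>" and ?f = "remainder_map X T \<iota>"
  let ?h = "case_sum \<iota> id"
  note adm = admissible_remainder_map[OF op]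
  have sub: "\<iota> ` topspace X \<subseteq> topspace T" using op openin_subset by blast
  have inj: "inj_on \<iota> (topspace X)"
    using \<iota> embedding_map_def homeomorphic_imp_injective_map by blast
  have tW: "topspace ?W = topspace T - \<iota> ` topspace X" by (auto simp: remainder_def)
  have clW: "closedin T (topspace ?W)" using op tW by (simp add: closedin_def Diff_Diff_Int sub inf_absorb2)
  have bij: "bij_betw ?h (topspace X <+> topspace ?W) (topspace T)"
    unfolding bij_betw_def
  proof
    show "inj_on ?h (topspace X <+> topspace ?W)"
      using inj unfolding inj_on_def tW by (auto split: sum.splits)
    show "?h ` (topspace X <+> topspace ?W) = topspace T"
      using sub unfolding tW Plus_def by (auto simp: image_Un image_image)
  qed
  have iff: "closedin (glueing X ?W ?f) C \<longleftrightarrow> closedin T (?h ` C)"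
    if C: "C \<subseteq> topspace X <+> topspace ?W" for C
  proof -
    define A B where "A = Inl -` C" and "B = Inr -` C"
    have AX: "A \<subseteq> topspace X" and BW: "B \<subseteq> topspace ?W" using C by (auto simp: A_def B_def)
    have "C = A <+> B" unfolding A_def B_def
      by (auto simp: Plus_def image_iff) (metis obj_sumE)
    then have hC: "?h ` C = \<iota> ` A \<union> B" by (auto simp: Plus_def image_Un image_image)
    have clA: "closedin X A \<longleftrightarrow> closedin (subtopology T (\<iota> ` topspace X)) (\<iota> ` A)"
      using \<iota> AX unfolding embedding_map_def by (meson homeomorphic_map_closedness)
    have *: "closedin X A \<longleftrightarrow> T closure_of (\<iota> ` A) \<inter> \<iota> ` topspace X \<subseteq> \<iota> ` A"
    proof
      assume "closedin X A"
      then obtain D where D: "closedin T D" "\<iota> ` A = D \<inter> \<iota> ` topspace X"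
        using clA closedin_subtopology by metis
      then have "T closure_of (\<iota> ` A) \<subseteq> D" by (intro closure_of_minimal) auto
      with D show "T closure_of (\<iota> ` A) \<inter> \<iota> ` topspace X \<subseteq> \<iota> ` A" by blast
    next
      assume r: "T closure_of (\<iota> ` A) \<inter> \<iota> ` topspace X \<subseteq> \<iota> ` A"
      have "\<iota> ` A \<subseteq> T closure_of (\<iota> ` A)" using AX sub by (intro closure_of_subset) blast
      then have "\<iota> ` A = T closure_of (\<iota> ` A) \<inter> \<iota> ` topspace X" using r AX by blast
      then show "closedin X A" unfolding clA closedin_subtopology
        by (metis closedin_closure_of)
    qed
    have cB: "closedin ?W B \<longleftrightarrow> closedin T B"
    proof -
      have "?W = subtopology T (topspace ?W)" unfolding tW by (simp add: remainder_def)
      then show ?thesis using closedin_closed_subtopology[OF clW, of B] BW by simp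
    qed
    have "closedin (glueing X ?W ?f) C \<longleftrightarrow> closedin X A \<and> closedin T B \<and> ?f A \<subseteq> B"
      unfolding closedin_glueing[OF adm] using C cB by (simp add: A_def B_def)
    also have "\<dots> \<longleftrightarrow> closedin T (\<iota> ` A \<union> B)"
    proof
      assume a: "closedin X A \<and> closedin T B \<and> ?f A \<subseteq> B"
      have "T closure_of (\<iota> ` A \<union> B) = T closure_of (\<iota> ` A) \<union> B"
        using a by (simp add: closure_of_closedin)
      also have "\<dots> \<subseteq> \<iota> ` A \<union> B" using a * unfolding remainder_map_def by blast
      finally show "closedin T (\<iota> ` A \<union> B)"
        using AX BW sub tW by (subst closure_of_subset_eq[symmetric]) auto
    next
      assume c: "closedin T (\<iota> ` A \<union> B)"
      have m: "T closure_of (\<iota> ` A) \<subseteq> \<iota> ` A \<union> B" using c by (intro closure_of_minimal) auto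
      have "B = (\<iota> ` A \<union> B) \<inter> topspace ?W" using AX BW tW by auto
      then have "closedin T B" using c clW by (metis closedin_Int)
      moreover have "T closure_of (\<iota> ` A) \<inter> \<iota> ` topspace X \<subseteq> \<iota> ` A" using m BW tW by blast
      moreover have "?f A \<subseteq> B" using m AX unfolding remainder_map_def by blast
      ultimately show "closedin X A \<and> closedin T B \<and> ?f A \<subseteq> B" using * by blast
    qed
    finally show ?thesis unfolding hC .
  qed
  show ?thesis
  proof (rule bijective_closed_imp_homeomorphic_map)
    have img: "?h ` (topspace X <+> topspace ?W) = topspace T" using bij by (simp add: bij_betw_def)
    show "?h ` topspace (glueing X ?W ?f) = topspace T" "inj_on ?h (topspace (glueing X ?W ?f))"
      using bij by (simp_all add: bij_betw_def topspace_glueing[OF adm])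
    show "closed_map (glueing X ?W ?f) T ?h"
      unfolding closed_map_def using iff closedin_subset topspace_glueing[OF adm] by blast
    have "closedin (glueing X ?W ?f) {x \<in> topspace X <+> topspace ?W. ?h x \<in> D}"
      if D: "closedin T D" for D
    proof -
      have "?h ` {x \<in> topspace X <+> topspace ?W. ?h x \<in> D} =
          ?h ` (topspace X <+> topspace ?W) \<inter> D" by blast
      also have "\<dots> = D" using closedin_subset[OF D] unfolding img by blast
      finally show ?thesis using D by (subst iff) auto
    qed
    then show "continuous_map (glueing X ?W ?f) T ?h"
      unfolding continuous_map_closedin topspace_glueing[OF adm] using img by blast
  qed
qed


section \<open>Cauchy completion\<close>

text \<open>The library proves that completions exist but has no constant for the Cauchy completion;
  here it is the set of Cauchy sequences modulo null sequences.\<close>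

context Metric_space
begin

definition cauchy_equiv :: "((nat \<Rightarrow> 'a) \<times> (nat \<Rightarrow> 'a)) set" where
  "cauchy_equiv = {(s, t). MCauchy s \<and> MCauchy t \<and> (\<lambda>n. d (s n) (t n)) \<longlonglongrightarrow> 0}"

definition cauchy_completion :: "(nat \<Rightarrow> 'a) set set" where
  "cauchy_completion = {s. MCauchy s} // cauchy_equiv"

text \<open>The library's \<open>Metric_space\<close> requires nonnegativity and symmetry also off the carrier, so
  distances are set to \<open>0\<close> there.\<close>

definition completion_dist :: "(nat \<Rightarrow> 'a) set \<Rightarrow> (nat \<Rightarrow> 'a) set \<Rightarrow> real" where
  "completion_dist P Q =
     (if P \<in> cauchy_completion \<and> Q \<in> cauchy_completion
      then THE r. \<forall>s\<in>P. \<forall>t\<in>Q. (\<lambda>n. d (s n) (t n)) \<longlonglongrightarrow> r else 0)"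

definition completion_embed :: "'a \<Rightarrow> (nat \<Rightarrow> 'a) set" where
  "completion_embed x = cauchy_equiv `` {\<lambda>_. x}"

lemma cauchy_seqs_convergent:
  assumes s: "MCauchy s" and t: "MCauchy t"
  shows "convergent (\<lambda>n. d (s n) (t n))"
proof -
  have M: "s n \<in> M" "t n \<in> M" for n using s t unfolding MCauchy_def by auto
  have "Cauchy (\<lambda>n. d (s n) (t n))"
  proof (rule metric_CauchyI)
    fix e :: real assume "e > 0"
    then have "e / 2 > 0" by simp
    then obtain N1 N2 where
      N: "\<And>m n. m \<ge> N1 \<Longrightarrow> n \<ge> N1 \<Longrightarrow> d (s m) (s n) < e/2"
         "\<And>m n. m \<ge> N2 \<Longrightarrow> n \<ge> N2 \<Longrightarrow> d (t m) (t n) < e/2"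
      using s t unfolding MCauchy_def by metis
    show "\<exists>N. \<forall>m\<ge>N. \<forall>n\<ge>N. dist (d (s m) (t m)) (d (s n) (t n)) < e"
    proof (intro exI allI impI)
      fix m n assume mn: "m \<ge> max N1 N2" "n \<ge> max N1 N2"
      have "d (s m) (t m) \<le> d (s m) (s n) + d (s n) (t n) + d (t m) (t n)"
        using triangle[of "s m" "s n" "t m"] triangle[of "s n" "t n" "t m"] M commute[of "t m" "t n"] by fastforce
      moreover have "d (s n) (t n) \<le> d (s m) (s n) + d (s m) (t m) + d (t m) (t n)"
        using triangle[of "s n" "s m" "t n"] triangle[of "s m" "t m" "t n"] M commute[of "s m" "s n"] by fastforce
      ultimately show "dist (d (s m) (t m)) (d (s n) (t n)) < e"
        using N(1)[of m n] N(2)[of m n] mn by (simp add: dist_real_def abs_le_iff)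
    qed
  qed
  then show ?thesis by (rule Cauchy_convergent)
qed

lemma equiv_cauchy_equiv: "equiv {s. MCauchy s} cauchy_equiv"
proof (rule equivI)
  have M: "MCauchy s \<Longrightarrow> s n \<in> M" for s n unfolding MCauchy_def by auto
  show "cauchy_equiv \<subseteq> {s. MCauchy s} \<times> {s. MCauchy s}"
    by (auto simp: cauchy_equiv_def)
  show "refl_on {s. MCauchy s} cauchy_equiv"
    using M by (auto simp: refl_on_def cauchy_equiv_def)
  show "sym cauchy_equiv" by (auto simp: sym_def cauchy_equiv_def commute)
  show "trans cauchy_equiv"
  proof (rule transI)
    fix s t u assume "(s, t) \<in> cauchy_equiv" "(t, u) \<in> cauchy_equiv"
    then have a: "MCauchy s" "MCauchy t" "MCauchy u" "(\<lambda>n. d (s n) (t n) + d (t n) (u n)) \<longlonglongrightarrow> 0"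
      using tendsto_add_zero by (auto simp: cauchy_equiv_def)
    have "(\<lambda>n. d (s n) (u n)) \<longlonglongrightarrow> 0"
      by (rule Lim_null_comparison[OF _ a(4)]) (use a M triangle in auto)
    then show "(s, u) \<in> cauchy_equiv" using a by (simp add: cauchy_equiv_def)
  qed
qed

lemma completion_dist_class:
  assumes s: "MCauchy s" and t: "MCauchy t"
  shows "(\<lambda>n. d (s n) (t n)) \<longlonglongrightarrow> completion_dist (cauchy_equiv `` {s}) (cauchy_equiv `` {t})"
proof -
  have M: "MCauchy s \<Longrightarrow> s n \<in> M" for s n unfolding MCauchy_def by auto
  have in_c: "cauchy_equiv `` {u} \<in> cauchy_completion" if "MCauchy u" for u
    using that by (auto simp: cauchy_completion_def intro: quotientI)
  obtain r where r: "(\<lambda>n. d (s n) (t n)) \<longlonglongrightarrow> r"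
    using cauchy_seqs_convergent[OF s t] by (auto simp: convergent_def)
  have all: "(\<lambda>n. d (s' n) (t' n)) \<longlonglongrightarrow> r"
    if "(s, s') \<in> cauchy_equiv" "(t, t') \<in> cauchy_equiv" for s' t'
  proof (rule Lim_transform[OF r], rule Lim_null_comparison)
    have a: "MCauchy s'" "MCauchy t'" "(\<lambda>n. d (s n) (s' n) + d (t n) (t' n)) \<longlonglongrightarrow> 0"
      using that tendsto_add_zero by (auto simp: cauchy_equiv_def)
    show "(\<lambda>n. d (s n) (s' n) + d (t n) (t' n)) \<longlonglongrightarrow> 0" by fact
    show "\<forall>\<^sub>F n in sequentially.
      norm (d (s' n) (t' n) - d (s n) (t n)) \<le> d (s n) (s' n) + d (t n) (t' n)"
    proof (intro always_eventually allI)
      fix n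
      have m: "s n \<in> M" "t n \<in> M" "s' n \<in> M" "t' n \<in> M" using M s t a by auto
      show "norm (d (s' n) (t' n) - d (s n) (t n)) \<le> d (s n) (s' n) + d (t n) (t' n)"
        using triangle[of "s' n" "s n" "t' n"] triangle[of "s n" "t n" "t' n"]
          triangle[of "s n" "s' n" "t n"] triangle[of "s' n" "t' n" "t n"] m
          commute[of "s n" "s' n"] commute[of "t n" "t' n"] by (simp add: abs_le_iff)
    qed
  qed
  have refl: "(s, s) \<in> cauchy_equiv" "(t, t) \<in> cauchy_equiv"
    using s t M by (auto simp: cauchy_equiv_def)
  have "completion_dist (cauchy_equiv `` {s}) (cauchy_equiv `` {t}) = r"
    unfolding completion_dist_def if_P[OF conjI[OF in_c[OF s] in_c[OF t]]]
  proof (rule the_equality)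
    show "\<forall>s'\<in>cauchy_equiv `` {s}. \<forall>t'\<in>cauchy_equiv `` {t}. (\<lambda>n. d (s' n) (t' n)) \<longlonglongrightarrow> r"
      using all by blast
    show "r' = r"
      if "\<forall>s'\<in>cauchy_equiv `` {s}. \<forall>t'\<in>cauchy_equiv `` {t}. (\<lambda>n. d (s' n) (t' n)) \<longlonglongrightarrow> r'" for r'
      using that refl LIMSEQ_unique[OF _ r] by blast
  qed
  with r show ?thesis by simp
qed

lemma cauchy_completion_cases:
  assumes "P \<in> cauchy_completion"
  obtains s where "MCauchy s" "P = cauchy_equiv `` {s}"
  using assms unfolding cauchy_completion_def quotient_def by auto

lemma Metric_space_cauchy_completion: "Metric_space cauchy_completion completion_dist"
proof
  have M: "MCauchy s \<Longrightarrow> s n \<in> M" for s n unfolding MCauchy_def by auto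
  show "0 \<le> completion_dist P Q" for P Q
  proof (cases "P \<in> cauchy_completion \<and> Q \<in> cauchy_completion")
    case True
    then obtain s t where st: "MCauchy s" "P = cauchy_equiv `` {s}" "MCauchy t" "Q = cauchy_equiv `` {t}"
      using cauchy_completion_cases by metis
    show ?thesis
      using completion_dist_class[OF st(1,3)] unfolding st(2,4) by (rule LIMSEQ_le_const) simp
  qed (auto simp: completion_dist_def)
  show "completion_dist P Q = completion_dist Q P" for P Q
  proof (cases "P \<in> cauchy_completion \<and> Q \<in> cauchy_completion")
    case True
    then obtain s t where st: "MCauchy s" "P = cauchy_equiv `` {s}" "MCauchy t" "Q = cauchy_equiv `` {t}"
      using cauchy_completion_cases by metis
    have "(\<lambda>n. d (s n) (t n)) = (\<lambda>n. d (t n) (s n))" by (simp add: commute)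
    then show ?thesis
      using completion_dist_class[OF st(1,3)] completion_dist_class[OF st(3,1)]
      unfolding st(2,4) by (simp add: LIMSEQ_unique)
  qed (auto simp: completion_dist_def)
  fix P Q assume "P \<in> cauchy_completion" "Q \<in> cauchy_completion"
  then obtain s t where st: "MCauchy s" "P = cauchy_equiv `` {s}" "MCauchy t" "Q = cauchy_equiv `` {t}"
    using cauchy_completion_cases by metis
  have "completion_dist P Q = 0 \<longleftrightarrow> (\<lambda>n. d (s n) (t n)) \<longlonglongrightarrow> 0"
    using completion_dist_class[OF st(1,3)] LIMSEQ_unique unfolding st(2,4) by metis
  also have "\<dots> \<longleftrightarrow> (s, t) \<in> cauchy_equiv" using st by (simp add: cauchy_equiv_def)
  also have "\<dots> \<longleftrightarrow> P = Q"
    using st eq_equiv_class_iff[OF equiv_cauchy_equiv, of s t] by simp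
  finally show "completion_dist P Q = 0 \<longleftrightarrow> P = Q" .
  fix R assume "R \<in> cauchy_completion"
  then obtain u where u: "MCauchy u" "R = cauchy_equiv `` {u}"
    using cauchy_completion_cases by metis
  have "(\<lambda>n. d (s n) (t n) + d (t n) (u n)) \<longlonglongrightarrow> completion_dist P Q + completion_dist Q R"
    unfolding st(2,4) u(2) by (intro tendsto_add completion_dist_class st u)
  moreover have "(\<lambda>n. d (s n) (u n)) \<longlonglongrightarrow> completion_dist P R"
    unfolding st(2,4) u(2) by (intro completion_dist_class st u)
  moreover have "\<exists>N. \<forall>n\<ge>N. d (s n) (u n) \<le> d (s n) (t n) + d (t n) (u n)"
    using triangle[OF M[OF st(1)] M[OF st(3)] M[OF u(1)]] by blast
  ultimately show "completion_dist P R \<le> completion_dist P Q + completion_dist Q R"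
    using LIMSEQ_le by blast
qed

lemma
  assumes "x \<in> M"
  shows completion_embed_in: "completion_embed x \<in> cauchy_completion"
    and MCauchy_const': "MCauchy (\<lambda>_. x)"
  using assms unfolding completion_embed_def cauchy_completion_def
  by (auto simp: MCauchy_def intro!: quotientI)

lemma completion_dist_embed:
  assumes "x \<in> M" "y \<in> M"
  shows "completion_dist (completion_embed x) (completion_embed y) = d x y"
  using completion_dist_class[OF MCauchy_const'[OF assms(1)] MCauchy_const'[OF assms(2)]]
  unfolding completion_embed_def by (simp add: LIMSEQ_const_iff)

lemma completion_embed_approx:
  assumes P: "P \<in> cauchy_completion" and e: "e > 0"
  shows "\<exists>x\<in>M. completion_dist P (completion_embed x) < e"
proof -
  obtain s where s: "MCauchy s" "P = cauchy_equiv `` {s}" using P cauchy_completion_cases by metis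
  have M: "s n \<in> M" for n using s unfolding MCauchy_def by auto
  obtain N where N: "\<And>m n. m \<ge> N \<Longrightarrow> n \<ge> N \<Longrightarrow> d (s m) (s n) < e/2"
    using s(1) e unfolding MCauchy_def by (metis half_gt_zero)
  have "completion_dist P (completion_embed (s N)) \<le> e/2"
    using completion_dist_class[OF s(1) MCauchy_const'[OF M[of N]]]
    unfolding completion_embed_def s(2)[symmetric]
    by (rule LIMSEQ_le_const2) (use N less_imp_le in blast)
  then show ?thesis using e M[of N] by (intro bexI[of _ "s N"]) auto
qed

lemma closure_of_completion_embed:
  "Metric_space.mtopology cauchy_completion completion_dist closure_of (completion_embed ` M)
     = cauchy_completion"
proof -
  interpret C: Metric_space cauchy_completion completion_dist by (rule Metric_space_cauchy_completion)
  show ?thesis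
    unfolding C.metric_closure_of C.in_mball
    using completion_embed_in completion_embed_approx by blast
qed

lemma mcomplete_cauchy_completion: "Metric_space.mcomplete cauchy_completion completion_dist"
proof -
  interpret C: Metric_space cauchy_completion completion_dist by (rule Metric_space_cauchy_completion)
  show ?thesis
    unfolding C.mcomplete_def
  proof (intro allI impI)
    fix P assume "C.MCauchy P"
    then have PC: "P n \<in> cauchy_completion" for n by (auto simp: C.MCauchy_def)
    have "\<exists>x\<in>M. completion_dist (P n) (completion_embed x) < inverse (Suc n)" for n
      by (intro completion_embed_approx PC) simp
    then obtain x where x: "\<And>n. x n \<in> M"
      "\<And>n. completion_dist (P n) (completion_embed (x n)) < inverse (Suc n)" by metis
    have *: "\<exists>N. \<forall>m\<ge>N. \<forall>n\<ge>N. d (x m) (x n) < e \<and> completion_dist (P n) (completion_embed (x n)) < e"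
      if "e > 0" for e :: real
    proof -
      have "e/3 > 0" using that by simp
      then have "\<exists>N. \<forall>n n'. N \<le> n \<longrightarrow> N \<le> n' \<longrightarrow> completion_dist (P n) (P n') < e/3"
        using \<open>C.MCauchy P\<close> unfolding C.MCauchy_def by blast
      then obtain N1 where N1: "\<And>n n'. n \<ge> N1 \<Longrightarrow> n' \<ge> N1 \<Longrightarrow> completion_dist (P n) (P n') < e/3"
        by blast
      obtain N2 where N2: "inverse (Suc N2) < e/3" using reals_Archimedean[OF \<open>e/3 > 0\<close>] by blast
      have b: "completion_dist (P n) (completion_embed (x n)) < e/3" if "n \<ge> N2" for n
      proof -
        have "inverse (real (Suc n)) \<le> inverse (real (Suc N2))" using that by (intro le_imp_inverse_le) auto
        then show ?thesis using x(2)[of n] N2 by linarith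
      qed
      show ?thesis
      proof (intro exI allI impI)
        fix m n assume mn: "m \<ge> max N1 N2" "n \<ge> max N1 N2"
        have "d (x m) (x n) = completion_dist (completion_embed (x m)) (completion_embed (x n))"
          using x completion_dist_embed by simp
        also have "\<dots> \<le> completion_dist (completion_embed (x m)) (P m) + completion_dist (P m) (P n)
            + completion_dist (P n) (completion_embed (x n))"
          using C.triangle[OF completion_embed_in[OF x(1)[of m]] PC[of m] completion_embed_in[OF x(1)[of n]]]
            C.triangle[OF PC[of m] PC[of n] completion_embed_in[OF x(1)[of n]]] by linarith
        also have "\<dots> < e"
          using N1[of m n] b[of m] b[of n] mn C.commute[of "completion_embed (x m)" "P m"] by simp
        finally show "d (x m) (x n) < e \<and> completion_dist (P n) (completion_embed (x n)) < e"
          using b[of n] mn that by simp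
      qed
    qed
    have mx: "MCauchy x" unfolding MCauchy_def using x(1) * by blast
    define Q where "Q = cauchy_equiv `` {x}"
    have QC: "Q \<in> cauchy_completion" using mx by (auto simp: Q_def cauchy_completion_def intro: quotientI)
    have "limitin C.mtopology P Q sequentially"
      unfolding C.limitin_metric
    proof (intro conjI allI impI QC)
      fix e :: real assume "e > 0"
      then obtain N where N: "\<And>m n. m \<ge> N \<Longrightarrow> n \<ge> N \<Longrightarrow>
          d (x m) (x n) < e/3 \<and> completion_dist (P n) (completion_embed (x n)) < e/3"
        using *[of "e/3"] by auto
      have "completion_dist (P n) Q < e" if n: "n \<ge> N" for n
      proof -
        have "completion_dist (completion_embed (x n)) Q \<le> e/3"
          using completion_dist_class[OF MCauchy_const'[OF x(1)[of n]] mx]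
          unfolding completion_embed_def Q_def
          by (rule LIMSEQ_le_const2) (use N n less_imp_le in blast)
        moreover have "completion_dist (P n) Q \<le>
            completion_dist (P n) (completion_embed (x n)) + completion_dist (completion_embed (x n)) Q"
          by (intro C.triangle PC QC completion_embed_in x)
        ultimately show ?thesis using N[OF n n] \<open>e > 0\<close> by linarith
      qed
      then show "\<forall>\<^sub>F n in sequentially. P n \<in> cauchy_completion \<and> completion_dist (P n) Q < e"
        using PC by (auto simp: eventually_sequentially)
    qed
    then show "\<exists>Q. limitin C.mtopology P Q sequentially" by blast
  qed
qed


end


section \<open>Graphs and Floyd compactifications\<close>

text \<open>A graph is given by its vertex set and its adjacency relation: nothing below depends on loops
  (which are allowed) or on multiplicities of edges.\<close>

definition graph :: "'a set \<Rightarrow> ('a \<Rightarrow> 'a \<Rightarrow> bool) \<Rightarrow> bool" where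
  "graph V E \<longleftrightarrow> (\<forall>x y. E x y \<longrightarrow> x \<in> V \<and> y \<in> V \<and> E y x)"

definition locally_finite :: "'a set \<Rightarrow> ('a \<Rightarrow> 'a \<Rightarrow> bool) \<Rightarrow> bool" where
  "locally_finite V E \<longleftrightarrow> (\<forall>x\<in>V. finite {y. E x y})"

definition paths :: "'a set \<Rightarrow> ('a \<Rightarrow> 'a \<Rightarrow> bool) \<Rightarrow> 'a \<Rightarrow> 'a \<Rightarrow> 'a list set" where
  "paths V E x y = {p. p \<noteq> [] \<and> set p \<subseteq> V \<and> successively E p \<and> hd p = x \<and> last p = y}"

definition connected_graph :: "'a set \<Rightarrow> ('a \<Rightarrow> 'a \<Rightarrow> bool) \<Rightarrow> bool" where
  "connected_graph V E \<longleftrightarrow> (\<forall>x\<in>V. \<forall>y\<in>V. paths V E x y \<noteq> {})"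

definition graph_dist :: "'a set \<Rightarrow> ('a \<Rightarrow> 'a \<Rightarrow> bool) \<Rightarrow> 'a \<Rightarrow> 'a \<Rightarrow> nat" where
  "graph_dist V E x y = (INF p\<in>paths V E x y. length p - 1)"

definition floyd_map :: "(nat \<Rightarrow> real) \<Rightarrow> bool" where
  "floyd_map f \<longleftrightarrow> (\<forall>n. f n > 0) \<and> (\<exists>k>0. \<forall>n. 1 \<le> f n / f (Suc n) \<and> f n / f (Suc n) \<le> k) \<and> summable f"

text \<open>Here \<open>d(v, {x\<^sub>i, x\<^sub>i\<^sub>+\<^sub>1})\<close> is the distance from a point to a set.\<close>

definition floyd_length ::
  "'a set \<Rightarrow> ('a \<Rightarrow> 'a \<Rightarrow> bool) \<Rightarrow> (nat \<Rightarrow> real) \<Rightarrow> 'a \<Rightarrow> 'a list \<Rightarrow> real" where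
  "floyd_length V E f v p =
     (\<Sum>i<length p - 1. f (min (graph_dist V E v (p ! i)) (graph_dist V E v (p ! Suc i))))"

definition floyd_dist ::
  "'a set \<Rightarrow> ('a \<Rightarrow> 'a \<Rightarrow> bool) \<Rightarrow> (nat \<Rightarrow> real) \<Rightarrow> 'a \<Rightarrow> 'a \<Rightarrow> 'a \<Rightarrow> real" where
  "floyd_dist V E f v x y =
     (if x \<in> V \<and> y \<in> V then INF p\<in>paths V E x y. floyd_length V E f v p else 0)"

lemma floyd_map_antimono:
  assumes "floyd_map f" "m \<le> n"
  shows "f n \<le> f m"
proof -
  have "f (Suc k) \<le> f k" for k
    using assms(1) unfolding floyd_map_def by (metis le_divide_eq_1_pos)
  then show ?thesis using lift_Suc_antimono_le assms(2) by metis
qed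

lemma floyd_length_nonneg: "floyd_map f \<Longrightarrow> 0 \<le> floyd_length V E f v p"
  unfolding floyd_length_def floyd_map_def by (intro sum_nonneg) (simp add: less_imp_le)

lemma floyd_dist_isolated:
  assumes f: "floyd_map f" and c: "connected_graph V E" and xy: "x \<in> V" "y \<in> V" "x \<noteq> y"
  shows "f (graph_dist V E v x) \<le> floyd_dist V E f v x y"
proof -
  have "f (graph_dist V E v x) \<le> floyd_length V E f v p" if p: "p \<in> paths V E x y" for p
  proof -
    have "length p - 1 > 0"
      using p xy unfolding paths_def by (cases p; cases "tl p") auto
    then have "f (min (graph_dist V E v (p ! 0)) (graph_dist V E v (p ! Suc 0))) \<le> floyd_length V E f v p"
      unfolding floyd_length_def
      by (intro member_le_sum[where f = "\<lambda>i. f (min (graph_dist V E v (p ! i)) (graph_dist V E v (p ! Suc i)))" and i = 0])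
        (use f in \<open>auto simp: floyd_map_def less_imp_le\<close>)
    moreover have "p ! 0 = x" using p by (auto simp: paths_def hd_conv_nth)
    moreover have "f (graph_dist V E v x) \<le> f (min (graph_dist V E v x) (graph_dist V E v (p ! Suc 0)))"
      by (intro floyd_map_antimono[OF f]) simp
    ultimately show ?thesis by simp
  qed
  then show ?thesis
    using xy c unfolding floyd_dist_def connected_graph_def by (auto intro!: cINF_greatest)
qed

lemma paths_rev:
  assumes "graph V E" "p \<in> paths V E x y"
  shows "rev p \<in> paths V E y x"
proof -
  have "successively E (rev p)"
    unfolding successively_rev
    by (rule successively_mono[of E]) (use assms in \<open>auto simp: paths_def graph_def\<close>)
  then show ?thesis using assms(2) by (auto simp: paths_def hd_rev last_rev)
qed

lemma floyd_length_rev: "floyd_length V E f v (rev p) = floyd_length V E f v p"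
proof -
  let ?g = "\<lambda>i. f (min (graph_dist V E v (p ! i)) (graph_dist V E v (p ! Suc i)))"
  have "floyd_length V E f v (rev p) = (\<Sum>i<length p - 1. ?g (length p - 1 - Suc i))"
    unfolding floyd_length_def length_rev
  proof (rule sum.cong[OF refl])
    fix i assume "i \<in> {..<length p - 1}"
    then have "rev p ! i = p ! Suc (length p - 1 - Suc i)" "rev p ! Suc i = p ! (length p - 1 - Suc i)"
      by (auto simp: rev_nth intro: arg_cong[where f = "nth p"])
    then show "f (min (graph_dist V E v (rev p ! i)) (graph_dist V E v (rev p ! Suc i))) =
        ?g (length p - 1 - Suc i)" by (simp add: min.commute)
  qed
  also have "\<dots> = (\<Sum>i<length p - 1. ?g i)" by (rule sum.nat_diff_reindex)
  finally show ?thesis by (simp add: floyd_length_def)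
qed

lemma paths_append:
  assumes p: "p \<in> paths V E x y" and q: "q \<in> paths V E y z"
  shows "p @ tl q \<in> paths V E x z"
    and "floyd_length V E f v (p @ tl q) = floyd_length V E f v p + floyd_length V E f v q"
proof -
  obtain q' where q': "q = y # q'" using q by (cases q) (auto simp: paths_def)
  show "p @ tl q \<in> paths V E x z"
    using p q unfolding q' by (auto simp: paths_def successively_append_iff successively_Cons)
  have ne: "p \<noteq> []" and lp: "last p = y" using p by (auto simp: paths_def)
  let ?g = "\<lambda>r i. f (min (graph_dist V E v (r ! i)) (graph_dist V E v (r ! Suc i)))"
  have nth: "(p @ q') ! (length p - 1 + i) = q ! i" for i
  proof (cases i)
    case (Suc j)
    then have "length p - 1 + i = length p + j" using ne by (cases p) auto
    then show ?thesis unfolding Suc by (simp only: nth_append q' nth_Cons_Suc) simp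
  qed (use ne lp in \<open>auto simp: nth_append q' last_conv_nth\<close>)
  have split: "(\<Sum>i<m + n. h i) = (\<Sum>i<m. h i) + (\<Sum>i<n. h (m + i))" for m n and h :: "nat \<Rightarrow> real"
    by (induction n) auto
  have "length (p @ q') - 1 = (length p - 1) + (length q - 1)" using ne by (cases p) (auto simp: q')
  then have "floyd_length V E f v (p @ tl q) =
      (\<Sum>i<length p - 1. ?g (p @ q') i) + (\<Sum>i<length q - 1. ?g (p @ q') (length p - 1 + i))"
    unfolding floyd_length_def q' list.sel by (simp only: split)
  also have "(\<Sum>i<length p - 1. ?g (p @ q') i) = floyd_length V E f v p"
    unfolding floyd_length_def by (intro sum.cong) (auto simp: nth_append)
  also have "(\<Sum>i<length q - 1. ?g (p @ q') (length p - 1 + i)) = floyd_length V E f v q"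
    unfolding floyd_length_def using nth by (simp only: add_Suc_right[symmetric])
  finally show "floyd_length V E f v (p @ tl q) = floyd_length V E f v p + floyd_length V E f v q" .
qed

lemma Metric_space_floyd_dist:
  assumes g: "graph V E" "connected_graph V E" and f: "floyd_map f"
  shows "Metric_space V (floyd_dist V E f v)"
proof
  have bdd: "bdd_below (floyd_length V E f v ` paths V E x y)" for x y
    using floyd_length_nonneg[OF f] by (intro bdd_belowI[of _ 0]) auto
  have ne: "paths V E x y \<noteq> {}" if "x \<in> V" "y \<in> V" for x y
    using g that by (auto simp: connected_graph_def)
  show nn: "0 \<le> floyd_dist V E f v x y" for x y
    using ne floyd_length_nonneg[OF f] unfolding floyd_dist_def by (auto intro!: cINF_greatest)
  have sub: "floyd_length V E f v ` paths V E x y \<subseteq> floyd_length V E f v ` paths V E y x" for x y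
  proof
    fix r assume "r \<in> floyd_length V E f v ` paths V E x y"
    then obtain p where p: "p \<in> paths V E x y" "r = floyd_length V E f v p" by blast
    show "r \<in> floyd_length V E f v ` paths V E y x"
      using paths_rev[OF g(1) p(1)] p(2) floyd_length_rev[of V E f v p] by (intro image_eqI[of _ _ "rev p"]) simp_all
  qed
  show "floyd_dist V E f v x y = floyd_dist V E f v y x" for x y
    unfolding floyd_dist_def using subset_antisym[OF sub[of x y] sub[of y x]] by simp
  fix x y assume x: "x \<in> V" and y: "y \<in> V"
  show "floyd_dist V E f v x y = 0 \<longleftrightarrow> x = y"
  proof
    assume "floyd_dist V E f v x y = 0"
    moreover have "0 < f (graph_dist V E v x)" using f by (simp add: floyd_map_def)
    ultimately show "x = y"
      using floyd_dist_isolated[OF f g(2) x y, of v] by linarith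
  next
    assume "x = y"
    moreover have "[x] \<in> paths V E x x" using x by (simp add: paths_def)
    moreover have "floyd_length V E f v [x] = 0" by (simp add: floyd_length_def)
    ultimately have "floyd_dist V E f v x y \<le> 0"
      using cINF_lower[OF bdd, of "[x]" x x] x by (simp add: floyd_dist_def)
    then show "floyd_dist V E f v x y = 0" using nn[of x y] by linarith
  qed
  fix z assume z: "z \<in> V"
  have "floyd_dist V E f v x z \<le> floyd_length V E f v p + floyd_length V E f v q"
    if "p \<in> paths V E x y" "q \<in> paths V E y z" for p q
    using paths_append(2)[OF that] cINF_lower[OF bdd paths_append(1)[OF that]] x z
    by (simp add: floyd_dist_def)
  then have "floyd_dist V E f v x z - floyd_length V E f v q \<le> floyd_dist V E f v x y"
    if "q \<in> paths V E y z" for q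
    using cINF_greatest[OF ne[OF x y], of "floyd_dist V E f v x z - floyd_length V E f v q"] x y that
    unfolding floyd_dist_def[of _ _ _ _ x y] by (simp add: diff_le_eq)
  then have "floyd_dist V E f v x z - floyd_dist V E f v x y \<le> floyd_dist V E f v y z"
    using cINF_greatest[OF ne[OF y z], of "floyd_dist V E f v x z - floyd_dist V E f v x y"] y z
    unfolding floyd_dist_def[of _ _ _ _ y z] by (simp add: algebra_simps)
  then show "floyd_dist V E f v x z \<le> floyd_dist V E f v x y + floyd_dist V E f v y z" by linarith
qed


definition floyd_compactification ::
  "'a set \<Rightarrow> ('a \<Rightarrow> 'a \<Rightarrow> bool) \<Rightarrow> (nat \<Rightarrow> real) \<Rightarrow> 'a \<Rightarrow> (nat \<Rightarrow> 'a) set topology" where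
  "floyd_compactification V E f v =
     Metric_space.mtopology (Metric_space.cauchy_completion V (floyd_dist V E f v))
       (Metric_space.completion_dist V (floyd_dist V E f v))"

definition floyd_embed ::
  "'a set \<Rightarrow> ('a \<Rightarrow> 'a \<Rightarrow> bool) \<Rightarrow> (nat \<Rightarrow> real) \<Rightarrow> 'a \<Rightarrow> 'a \<Rightarrow> (nat \<Rightarrow> 'a) set" where
  "floyd_embed V E f v = Metric_space.completion_embed V (floyd_dist V E f v)"


context
  fixes V :: "'a set" and E :: "'a \<Rightarrow> 'a \<Rightarrow> bool" and f :: "nat \<Rightarrow> real" and v :: 'a
  assumes g: "graph V E" "connected_graph V E" and f: "floyd_map f"
begin

interpretation F: Metric_space V "floyd_dist V E f v"
  by (rule Metric_space_floyd_dist[OF g f])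

interpretation C: Metric_space F.cauchy_completion F.completion_dist
  by (rule F.Metric_space_cauchy_completion)

lemma openin_floyd_embed_singleton:
  assumes x: "x \<in> V"
  shows "openin (floyd_compactification V E f v) {floyd_embed V E f v x}"
proof -
  let ?\<iota> = F.completion_embed
  let ?e = "f (graph_dist V E v x)"
  have e: "?e > 0" using f by (simp add: floyd_map_def)
  have "P = ?\<iota> x" if P: "P \<in> C.mball (?\<iota> x) ?e" for P
  proof (rule ccontr)
    assume "P \<noteq> ?\<iota> x"
    define r where "r = F.completion_dist (?\<iota> x) P"
    have PC: "P \<in> F.cauchy_completion" and r: "r < ?e" using P by (auto simp: r_def)
    note xC = F.completion_embed_in[OF x]
    have "r > 0" using \<open>P \<noteq> ?\<iota> x\<close> PC xC C.mdist_pos_less unfolding r_def by blast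
    then obtain y where y: "y \<in> V" "F.completion_dist P (?\<iota> y) < min r (?e - r)"
      using F.completion_embed_approx[OF PC, of "min r (?e - r)"] r by auto
    have "floyd_dist V E f v x y \<le> r + F.completion_dist P (?\<iota> y)"
      using C.triangle[OF xC PC F.completion_embed_in[OF y(1)]]
      by (simp add: F.completion_dist_embed[OF x y(1)] r_def)
    then have "floyd_dist V E f v x y < ?e" using y(2) by simp
    then have "x = y" using floyd_dist_isolated[OF f g(2) x y(1), of v] by fastforce
    then show False using y(2) C.commute[of P "?\<iota> x"] by (simp add: r_def)
  qed
  moreover have "?\<iota> x \<in> C.mball (?\<iota> x) ?e"
    using e F.completion_embed_in[OF x] C.zero by simp
  ultimately have "C.mball (?\<iota> x) ?e = {?\<iota> x}" by blast
  then show ?thesis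
    using C.openin_mball[of "?\<iota> x" ?e] by (simp add: floyd_compactification_def floyd_embed_def)
qed

lemma floyd_embed_open_embedding:
  shows "openin (floyd_compactification V E f v) (floyd_embed V E f v ` V)"
    and "embedding_map (discrete_topology V) (floyd_compactification V E f v) (floyd_embed V E f v)"
proof -
  let ?T = "floyd_compactification V E f v" and ?\<iota> = "floyd_embed V E f v"
  have op: "openin ?T (?\<iota> ` A)" if "A \<subseteq> V" for A
  proof -
    have "openin ?T (\<Union>x\<in>A. {?\<iota> x})" using that openin_floyd_embed_singleton by blast
    then show ?thesis by (simp add: UNION_singleton_eq_range)
  qed
  then show "openin ?T (?\<iota> ` V)" by simp
  show "embedding_map (discrete_topology V) ?T ?\<iota>"
  proof (rule injective_open_imp_embedding_map)
    show "continuous_map (discrete_topology V) ?T ?\<iota>"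
      using op[of V] openin_subset by (fastforce simp: Pi_iff)
    show "open_map (discrete_topology V) ?T ?\<iota>" using op by (simp add: open_map_def)
    show "inj_on ?\<iota> (topspace (discrete_topology V))"
    proof (rule inj_onI)
      fix x y assume "x \<in> topspace (discrete_topology V)" "y \<in> topspace (discrete_topology V)" "?\<iota> x = ?\<iota> y"
      then have xy: "x \<in> V" "y \<in> V" "F.completion_embed x = F.completion_embed y"
        by (auto simp: floyd_embed_def)
      then have "floyd_dist V E f v x y = 0"
        using F.completion_dist_embed[OF xy(1,2)] C.zero[OF F.completion_embed_in[OF xy(2)] F.completion_embed_in[OF xy(2)]]
        by simp
      then show "x = y" using xy by simp
    qed
  qed
qed

end


section \<open>Quasi-isometries with a distortion map\<close>

definition distortion_map :: "(nat \<Rightarrow> nat) \<Rightarrow> bool" where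
  "distortion_map \<alpha> \<longleftrightarrow> mono \<alpha> \<and> filterlim \<alpha> at_top at_top"

definition quasi_isometric ::
  "(nat \<Rightarrow> nat) \<Rightarrow> 'b set \<Rightarrow> ('b \<Rightarrow> 'b \<Rightarrow> nat) \<Rightarrow> 'a set \<Rightarrow> ('a \<Rightarrow> 'a \<Rightarrow> nat) \<Rightarrow> ('b \<Rightarrow> 'a) \<Rightarrow> bool" where
  "quasi_isometric \<alpha> X2 d2 X1 d1 \<pi> \<longleftrightarrow> \<pi> \<in> X2 \<rightarrow> X1 \<and>
     (\<forall>x\<in>X2. \<forall>y\<in>X2. d1 (\<pi> x) (\<pi> y) \<le> \<alpha> (d2 x y) \<and> d2 x y \<le> \<alpha> (d1 (\<pi> x) (\<pi> y)))"

definition quasi_inverse ::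
  "'b set \<Rightarrow> ('b \<Rightarrow> 'b \<Rightarrow> nat) \<Rightarrow> 'a set \<Rightarrow> ('a \<Rightarrow> 'a \<Rightarrow> nat) \<Rightarrow> ('b \<Rightarrow> 'a) \<Rightarrow> ('a \<Rightarrow> 'b) \<Rightarrow> bool" where
  "quasi_inverse X2 d2 X1 d1 \<pi> \<rho> \<longleftrightarrow> \<rho> \<in> X1 \<rightarrow> X2 \<and>
     (\<exists>K. \<forall>x\<in>X2. d2 (\<rho> (\<pi> x)) x \<le> K) \<and> (\<exists>K. \<forall>y\<in>X1. d1 (\<pi> (\<rho> y)) y \<le> K)"

definition quasi_isometry ::
  "(nat \<Rightarrow> nat) \<Rightarrow> 'b set \<Rightarrow> ('b \<Rightarrow> 'b \<Rightarrow> nat) \<Rightarrow> 'a set \<Rightarrow> ('a \<Rightarrow> 'a \<Rightarrow> nat) \<Rightarrow> ('b \<Rightarrow> 'a) \<Rightarrow> bool" where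
  "quasi_isometry \<alpha> X2 d2 X1 d1 \<pi> \<longleftrightarrow> quasi_isometric \<alpha> X2 d2 X1 d1 \<pi> \<and>
     (\<exists>\<rho>. quasi_inverse X2 d2 X1 d1 \<pi> \<rho> \<and> quasi_isometric \<alpha> X1 d1 X2 d2 \<rho>)"

end

theory Submission
  imports Defs
begin

text \<open>An edge of \<open>\<Gamma>\<^sub>2\<close> at distance \<open>n\<close> from the base point is sent by \<open>\<pi>\<close> to a pair of points at
  distance at most \<open>\<alpha> 1\<close>, whose distance \<open>m\<close> to the base point satisfies \<open>n \<le> \<alpha> m\<close> up to moving
  base points. Since \<open>f\<^sub>1 m \<le> D f\<^sub>2 (\<alpha> m) \<le> D f\<^sub>2 n\<close> and bounded shifts change \<open>f\<^sub>1\<close> by a bounded factor,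
  \<open>\<pi>\<close> is Lipschitz for the Floyd metrics; by symmetry so is its quasi-inverse \<open>\<rho>\<close>. Both extend to the
  completions. Points at bounded graph distance become arbitrarily close in the Floyd metric far from
  the base point, so the extensions are mutually inverse on the boundaries, and that of \<open>\<rho>\<close> matches the
  limit points of \<open>\<pi> A\<close> with those of \<open>A\<close>. This is what an isomorphism of glueings requires.\<close>

section \<open>Glueings along homeomorphic remainders\<close>

text \<open>A closed set of a glueing splits as \<open>A <+> B\<close>, and the only condition
  linking the two halves is \<open>f A \<subseteq> B\<close>. An injective \<open>g\<close> with
  \<open>g\<close> f A = f' A\<open>turns this into\<close>f' A \<subseteq> g \<open>B\<close>, so
  closedness is preserved in both directions.\<close>

lemma homeomorphic_map_glueing:
  assumes f: "admissible_map X W f" and f': "admissible_map X W' f'"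
    and g: "homeomorphic_map W W' g"
    and fg: "\<And>A. closedin X A \<Longrightarrow> g ` f A = f' A"
  shows "homeomorphic_map (glueing X W f) (glueing X W' f') (map_sum id g)"
proof -
  let ?h = "map_sum id g"
  have gW: "g ` topspace W = topspace W'" "inj_on g (topspace W)"
    using g by (auto simp: homeomorphic_imp_surjective_map homeomorphic_imp_injective_map)
  have inj: "inj_on ?h (topspace X <+> topspace W)"
    using gW(2) by (intro inj_onI) (auto dest: inj_onD)
  have img: "?h ` (A <+> B) = A <+> g ` B" for A :: "'a set" and B
    by (auto simp: Plus_def image_Un image_image)
  have iff: "closedin (glueing X W f) C \<longleftrightarrow> closedin (glueing X W' f') (?h ` C)"
    if C: "C \<subseteq> topspace X <+> topspace W" for C
  proof -
    define A B where "A = Inl -` C" and "B = Inr -` C"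
    have CAB: "C = A <+> B" unfolding A_def B_def
      by (auto simp: Plus_def image_iff) (metis obj_sumE)
    have AX: "A \<subseteq> topspace X" and BW: "B \<subseteq> topspace W" using C by (auto simp: A_def B_def)
    have v: "Inl -` (A <+> g ` B) = A" "Inr -` (A <+> g ` B) = g ` B" by auto
    \<comment> \<open>Injectivity of \<open>g\<close> is only known on \<open>topspace W\<close>, so
      \<open>f A\<close> must lie there before \<open>g\<close> can be cancelled from an inclusion
      of images.\<close>
    have "f A \<subseteq> topspace W" if "closedin X A"
      using f that closedin_subset unfolding admissible_map_def by blast
    then have "f A \<subseteq> B \<longleftrightarrow> f' A \<subseteq> g ` B" if "closedin X A"
      using fg[OF that] that BW gW(2) by (metis inj_on_image_subset_iff)
    moreover have "closedin W B \<longleftrightarrow> closedin W' (g ` B)"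
      using g BW by (meson homeomorphic_map_closedness)
    moreover have "A <+> g ` B \<subseteq> topspace X <+> topspace W'" using AX BW gW(1) by auto
    ultimately show ?thesis
      unfolding closedin_glueing[OF f] closedin_glueing[OF f'] A_def[symmetric] B_def[symmetric]
      unfolding CAB img v using C CAB by blast
  qed
  show ?thesis
  proof (rule bijective_closed_imp_homeomorphic_map)
    show surj: "?h ` topspace (glueing X W f) = topspace (glueing X W' f')"
      by (simp add: topspace_glueing f f' img gW)
    show "inj_on ?h (topspace (glueing X W f))" using inj by (simp add: topspace_glueing[OF f])
    show "closed_map (glueing X W f) (glueing X W' f') ?h"
      unfolding closed_map_def using iff closedin_subset topspace_glueing[OF f] by blast
    have "closedin (glueing X W f) {x \<in> topspace X <+> topspace W. ?h x \<in> D}"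
      if D: "closedin (glueing X W' f') D" for D
    proof -
      \<comment> \<open>By surjectivity \<open>D\<close> is the image of its own preimage, so
        \<open>iff\<close> read backwards gives continuity.\<close>
      have "?h ` {x \<in> topspace X <+> topspace W. ?h x \<in> D} = ?h ` topspace (glueing X W f) \<inter> D"
        by (auto simp: topspace_glueing[OF f])
      also have "\<dots> = D" using closedin_subset[OF D] unfolding surj by blast
      finally show ?thesis using D by (subst iff) auto
    qed
    moreover have "?h \<in> topspace (glueing X W f) \<rightarrow> topspace (glueing X W' f')" using surj by blast
    ultimately show "continuous_map (glueing X W f) (glueing X W' f') ?h"
      unfolding continuous_map_closedin topspace_glueing[OF f] by simp
  qed
qed


section \<open>Points of the Cauchy completion as limits\<close>

context Metric_space
begin

abbreviation cauchy_class :: "(nat \<Rightarrow> 'a) \<Rightarrow> (nat \<Rightarrow> 'a) set" where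
  "cauchy_class s \<equiv> cauchy_equiv `` {s}"

interpretation C: Metric_space cauchy_completion completion_dist
  by (rule Metric_space_cauchy_completion)

lemma cauchy_class_in: "MCauchy s \<Longrightarrow> cauchy_class s \<in> cauchy_completion"
  by (auto simp: cauchy_completion_def intro: quotientI)

lemma cauchy_class_eq_iff:
  "MCauchy s \<Longrightarrow> MCauchy t \<Longrightarrow> cauchy_class s = cauchy_class t \<longleftrightarrow> (\<lambda>n. d (s n) (t n)) \<longlonglongrightarrow> 0"
  using eq_equiv_class_iff[OF equiv_cauchy_equiv, of s t] by (simp add: cauchy_equiv_def)

text \<open>The Cauchy estimate for \<open>s\<close> passes to the limit defining
  \<open>completion_dist\<close>. Strictness is lost there, which is why the estimate is taken with
  \<open>e/2\<close>.\<close>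

lemma limitin_cauchy_class:
  assumes s: "MCauchy s"
  shows "limitin C.mtopology (\<lambda>n. completion_embed (s n)) (cauchy_class s) sequentially"
  unfolding C.limitin_metric
proof (intro conjI allI impI cauchy_class_in s)
  have sM: "s n \<in> M" for n using s by (auto simp: MCauchy_def)
  fix e :: real assume "e > 0"
  then obtain N where N: "\<And>m n. m \<ge> N \<Longrightarrow> n \<ge> N \<Longrightarrow> d (s m) (s n) < e/2"
    using s unfolding MCauchy_def by (metis half_gt_zero)
  have "completion_dist (completion_embed (s n)) (cauchy_class s) < e" if n: "n \<ge> N" for n
  proof -
    have "completion_dist (completion_embed (s n)) (cauchy_class s) \<le> e/2"
      using completion_dist_class[OF MCauchy_const'[OF sM[of n]] s]
      unfolding completion_embed_def
      by (rule LIMSEQ_le_const2) (use N n less_imp_le in blast)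
    with \<open>e > 0\<close> show ?thesis by simp
  qed
  then show "\<forall>\<^sub>F n in sequentially. completion_embed (s n) \<in> cauchy_completion \<and>
      completion_dist (completion_embed (s n)) (cauchy_class s) < e"
    using sM completion_embed_in by (auto simp: eventually_sequentially)
qed

text \<open>The embedding is isometric, so convergence in the completion makes \<open>s\<close>
  itself Cauchy; uniqueness of limits then identifies \<open>P\<close>.\<close>

lemma limitin_completion_embedD:
  assumes sM: "range s \<subseteq> M"
    and lim: "limitin C.mtopology (\<lambda>n. completion_embed (s n)) P sequentially"
  shows "MCauchy s" "P = cauchy_class s"
proof -
  have s: "s n \<in> M" for n using sM by auto
  have "C.MCauchy (\<lambda>n. completion_embed (s n))"
    using C.convergent_imp_MCauchy[OF _ lim] completion_embed_in s by auto
  then show "MCauchy s"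
    unfolding C.MCauchy_def MCauchy_def using completion_dist_embed s sM by simp
  from C.limitin_metric_unique[OF lim limitin_cauchy_class[OF this]]
  show "P = cauchy_class s" by simp
qed

text \<open>This turns limit points into sequences drawn from \<open>A\<close> itself, the form in
  which they can be transported by a map defined only on \<open>M\<close>.\<close>

lemma closure_of_completion_embed_iff:
  assumes A: "A \<subseteq> M"
  shows "P \<in> C.mtopology closure_of (completion_embed ` A) \<longleftrightarrow>
    (\<exists>s. MCauchy s \<and> range s \<subseteq> A \<and> P = cauchy_class s)"
proof
  assume "P \<in> C.mtopology closure_of (completion_embed ` A)"
  then obtain \<sigma> where \<sigma>: "range \<sigma> \<subseteq> completion_embed ` A" "limitin C.mtopology \<sigma> P sequentially"
    unfolding C.closure_of_sequentially by auto
  then have "\<forall>n. \<exists>x. x \<in> A \<and> \<sigma> n = completion_embed x" by blast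
  then obtain s where s: "\<And>n. s n \<in> A" "\<And>n. \<sigma> n = completion_embed (s n)" by metis
  have sA: "range s \<subseteq> A" using s(1) by auto
  moreover have "\<sigma> = (\<lambda>n. completion_embed (s n))" using s(2) by auto
  then have "limitin C.mtopology (\<lambda>n. completion_embed (s n)) P sequentially" using \<sigma>(2) by simp
  ultimately show "\<exists>s. MCauchy s \<and> range s \<subseteq> A \<and> P = cauchy_class s"
    using limitin_completion_embedD A by (metis subset_trans)
next
  assume "\<exists>s. MCauchy s \<and> range s \<subseteq> A \<and> P = cauchy_class s"
  then obtain s where s: "MCauchy s" "range s \<subseteq> A" "P = cauchy_class s" by blast
  have "range (\<lambda>n. completion_embed (s n)) \<subseteq> completion_embed ` A \<inter> cauchy_completion"
    using s(2) A completion_embed_in by auto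
  then show "P \<in> C.mtopology closure_of (completion_embed ` A)"
    unfolding C.closure_of_sequentially using limitin_cauchy_class[OF s(1)] s(3) cauchy_class_in[OF s(1)] by blast
qed

end


section \<open>Boundaries of metric spaces whose points are isolated\<close>

text \<open>\<open>N\<close> plays the role of the graph distance to the base point; \<open>d\<close> is the Floyd metric.\<close>

locale height_space = Metric_space M d for M :: "'a set" and d +
  fixes N :: "'a \<Rightarrow> nat"
  assumes isolated: "\<exists>e>0. \<forall>x\<in>M. \<forall>y\<in>M. N x \<le> n \<longrightarrow> x \<noteq> y \<longrightarrow> e \<le> d x y"
begin

text \<open>For a Floyd metric this is the Floyd boundary, the point set underlying the remainder of
  the compactification.\<close>

definition boundary :: "(nat \<Rightarrow> 'a) set set" where
  "boundary = cauchy_completion - completion_embed ` M"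

text \<open>If the heights do not tend to infinity, arbitrarily late terms have height below some
  fixed \<open>R\<close>. Points of height at most \<open>R\<close> are isolated with a common
  radius \<open>e\<close>, so a Cauchy tail finer than \<open>e\<close> must stay at such a
  term.\<close>

lemma MCauchy_constant_or_escapes:
  assumes s: "MCauchy s"
  shows "(\<exists>x\<in>M. \<forall>\<^sub>F n in sequentially. s n = x) \<or> filterlim (\<lambda>n. N (s n)) at_top sequentially"
proof (rule disjCI)
  have sM: "s n \<in> M" for n using s by (auto simp: MCauchy_def)
  assume "\<not> filterlim (\<lambda>n. N (s n)) at_top sequentially"
  then obtain R where R: "\<not> (\<forall>\<^sub>F n in sequentially. R \<le> N (s n))"
    unfolding filterlim_at_top by blast
  obtain e where e: "e > 0" "\<And>x y. x \<in> M \<Longrightarrow> y \<in> M \<Longrightarrow> N x \<le> R \<Longrightarrow> x \<noteq> y \<Longrightarrow> e \<le> d x y"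
    using isolated[of R] by blast
  obtain n0 where n0: "\<And>m n. m \<ge> n0 \<Longrightarrow> n \<ge> n0 \<Longrightarrow> d (s m) (s n) < e"
    using s e(1) unfolding MCauchy_def by metis
  obtain m where m: "m \<ge> n0" "N (s m) < R"
    using R unfolding eventually_sequentially by (metis not_le)
  have "s n = s m" if "n \<ge> n0" for n
    using n0[OF m(1) that] e(2)[OF sM[of m] sM[of n]] m(2) by fastforce
  then show "\<exists>x\<in>M. \<forall>\<^sub>F n in sequentially. s n = x"
    using sM by (auto simp: eventually_sequentially)
qed

text \<open>An eventually constant sequence represents an embedded point, which leaves escape as the
  only alternative for a boundary class. Conversely, isolation of \<open>x\<close> keeps sequences
  of larger height away from it.\<close>

lemma cauchy_class_in_boundary_iff:
  assumes s: "MCauchy s"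
  shows "cauchy_class s \<in> boundary \<longleftrightarrow> filterlim (\<lambda>n. N (s n)) at_top sequentially"
proof
  assume b: "cauchy_class s \<in> boundary"
  have "\<not> (\<forall>\<^sub>F n in sequentially. s n = x)" if x: "x \<in> M" for x
  proof
    assume "\<forall>\<^sub>F n in sequentially. s n = x"
    then have "\<forall>\<^sub>F n in sequentially. d (s n) x = 0"
      using x by (auto elim: eventually_mono)
    then have "cauchy_class s = completion_embed x"
      unfolding completion_embed_def cauchy_class_eq_iff[OF s MCauchy_const'[OF x]]
      by (rule tendsto_eventually)
    then show False using b x by (auto simp: boundary_def)
  qed
  then show "filterlim (\<lambda>n. N (s n)) at_top sequentially"
    using MCauchy_constant_or_escapes[OF s] by blast
next
  assume esc: "filterlim (\<lambda>n. N (s n)) at_top sequentially"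
  have sM: "s n \<in> M" for n using s by (auto simp: MCauchy_def)
  have "cauchy_class s \<noteq> completion_embed x" if x: "x \<in> M" for x
  proof
    assume "cauchy_class s = completion_embed x"
    then have lim: "(\<lambda>n. d (s n) x) \<longlonglongrightarrow> 0"
      using cauchy_class_eq_iff[OF s MCauchy_const'[OF x]] by (simp add: completion_embed_def)
    obtain e where e: "e > 0" "\<And>y z. y \<in> M \<Longrightarrow> z \<in> M \<Longrightarrow> N y \<le> N x \<Longrightarrow> y \<noteq> z \<Longrightarrow> e \<le> d y z"
      using isolated[of "N x"] by blast
    have "\<forall>\<^sub>F n in sequentially. d (s n) x < e" using lim e(1) by (rule order_tendstoD)
    \<comment> \<open>The successor makes the heights differ, hence \<open>s n\<close> differs from
      \<open>x\<close> and the isolation bound contradicts convergence to \<open>x\<close>.\<close>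
    moreover have "\<forall>\<^sub>F n in sequentially. Suc (N x) \<le> N (s n)"
      using esc by (simp add: filterlim_at_top)
    ultimately have "\<forall>\<^sub>F n in sequentially. False"
    proof eventually_elim
      case (elim n)
      then have "x \<noteq> s n" by auto
      then show ?case using e(2)[OF x sM[of n]] elim(1) commute[of x "s n"] by simp
    qed
    then show False by simp
  qed
  then show "cauchy_class s \<in> boundary" using cauchy_class_in[OF s] by (auto simp: boundary_def)
qed

lemma boundaryE:
  assumes "P \<in> boundary"
  obtains s where "MCauchy s" "P = cauchy_class s" "filterlim (\<lambda>n. N (s n)) at_top sequentially"
  using assms cauchy_completion_cases cauchy_class_in_boundary_iff by (metis DiffD1 boundary_def)

end

section \<open>Extension of Lipschitz maps to completions and boundaries\<close>

text \<open>The Lipschitz bound provides the extension to completions, and \<open>proper\<close>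
  makes that extension send boundary points to boundary points.\<close>

locale height_map = A: height_space M d N + B: height_space M' d' N'
  for M :: "'a set" and d N and M' :: "'b set" and d' N' +
  fixes \<phi> :: "'a \<Rightarrow> 'b" and K :: real
  assumes map_in: "x \<in> M \<Longrightarrow> \<phi> x \<in> M'"
    and lipschitz: "x \<in> M \<Longrightarrow> y \<in> M \<Longrightarrow> d' (\<phi> x) (\<phi> y) \<le> K * d x y"
    and proper: "range s \<subseteq> M \<Longrightarrow> filterlim (\<lambda>n. N (s n)) at_top sequentially \<Longrightarrow>
      filterlim (\<lambda>n. N' (\<phi> (s n))) at_top sequentially"
begin

text \<open>Composing a class with \<open>\<phi>\<close> need not yield a full class of the target,
  so the result is saturated under the target equivalence.\<close>

definition extend :: "(nat \<Rightarrow> 'a) set \<Rightarrow> (nat \<Rightarrow> 'b) set" where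
  "extend P = B.cauchy_equiv `` ((\<circ>) \<phi> ` P)"

interpretation CA: Metric_space A.cauchy_completion A.completion_dist
  by (rule A.Metric_space_cauchy_completion)

interpretation CB: Metric_space B.cauchy_completion B.completion_dist
  by (rule B.Metric_space_cauchy_completion)

lemma MCauchy_comp:
  assumes s: "A.MCauchy s"
  shows "B.MCauchy (\<phi> \<circ> s)"
  unfolding B.MCauchy_def
proof (intro conjI allI impI)
  have sM: "s n \<in> M" for n using s by (auto simp: A.MCauchy_def)
  then show "range (\<phi> \<circ> s) \<subseteq> M'" using map_in by auto
  fix e :: real assume "e > 0"
  \<comment> \<open>The sign of \<open>K\<close> is not fixed, so it is replaced by the larger and
    positive constant \<open>\<bar>K\<bar> + 1\<close>.\<close>
  then have "e / (\<bar>K\<bar> + 1) > 0" by (simp add: add_nonneg_pos)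
  then obtain n0 where n0: "\<And>m n. m \<ge> n0 \<Longrightarrow> n \<ge> n0 \<Longrightarrow> d (s m) (s n) < e / (\<bar>K\<bar> + 1)"
    using s unfolding A.MCauchy_def by metis
  have "d' (\<phi> (s m)) (\<phi> (s n)) < e" if "m \<ge> n0" "n \<ge> n0" for m n
  proof -
    have "d' (\<phi> (s m)) (\<phi> (s n)) \<le> K * d (s m) (s n)" using lipschitz sM by blast
    also have "\<dots> \<le> (\<bar>K\<bar> + 1) * d (s m) (s n)" by (intro mult_right_mono) auto
    also have "\<dots> < e" using n0[OF that] by (simp add: pos_less_divide_eq add_nonneg_pos mult.commute)
    finally show ?thesis .
  qed
  then show "\<exists>n0. \<forall>m n. n0 \<le> m \<longrightarrow> n0 \<le> n \<longrightarrow> d' ((\<phi> \<circ> s) m) ((\<phi> \<circ> s) n) < e" by auto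
qed

text \<open>The Lipschitz bound preserves null distances, so all representatives of a class have
  images in one and the same class.\<close>

lemma extend_cauchy_class:
  assumes s: "A.MCauchy s"
  shows "extend (A.cauchy_class s) = B.cauchy_class (\<phi> \<circ> s)"
proof -
  have "B.cauchy_class (\<phi> \<circ> t) = B.cauchy_class (\<phi> \<circ> s)" if "(s, t) \<in> A.cauchy_equiv" for t
  proof -
    have t: "A.MCauchy t" and lim: "(\<lambda>n. d (t n) (s n)) \<longlonglongrightarrow> 0"
      using that by (auto simp: A.cauchy_equiv_def A.commute)
    have M: "s n \<in> M" "t n \<in> M" for n using s t by (auto simp: A.MCauchy_def)
    have "(\<lambda>n. d' (\<phi> (t n)) (\<phi> (s n))) \<longlonglongrightarrow> 0"
      by (rule Lim_null_comparison[OF _ tendsto_mult_right_zero[OF lim, of K]])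
        (use lipschitz M in auto)
    then show ?thesis
      by (simp add: B.cauchy_class_eq_iff[OF MCauchy_comp[OF t] MCauchy_comp[OF s]])
  qed
  moreover have "(s, s) \<in> A.cauchy_equiv"
    using s A.equiv_cauchy_equiv by (auto simp: equiv_def refl_on_def)
  ultimately have "(\<Union>t\<in>A.cauchy_class s. B.cauchy_class (\<phi> \<circ> t)) = B.cauchy_class (\<phi> \<circ> s)"
    by blast
  moreover have "extend (A.cauchy_class s) = (\<Union>t\<in>A.cauchy_class s. B.cauchy_class (\<phi> \<circ> t))"
    unfolding extend_def by blast
  ultimately show ?thesis by simp
qed

lemma extend_boundary:
  assumes "P \<in> A.boundary"
  shows "extend P \<in> B.boundary"
proof -
  obtain s where s: "A.MCauchy s" "P = A.cauchy_class s" "filterlim (\<lambda>n. N (s n)) at_top sequentially"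
    using assms by (rule A.boundaryE)
  moreover have "range s \<subseteq> M" using s(1) by (simp add: A.MCauchy_def)
  ultimately show ?thesis
    using proper by (simp add: extend_cauchy_class B.cauchy_class_in_boundary_iff MCauchy_comp)
qed

text \<open>The Lipschitz inequality holds termwise along representatives and passes to the limit
  with the same constant \<open>K\<close>.\<close>

lemma continuous_map_extend: "continuous_map CA.mtopology CB.mtopology extend"
proof -
  have lip: "B.completion_dist (extend P) (extend Q) \<le> K * A.completion_dist P Q"
    and cl: "extend P \<in> B.cauchy_completion"
    if PQ: "P \<in> A.cauchy_completion" "Q \<in> A.cauchy_completion" for P Q
  proof -
    obtain s t where st: "A.MCauchy s" "P = A.cauchy_class s" "A.MCauchy t" "Q = A.cauchy_class t"
      using PQ A.cauchy_completion_cases by metis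
    show "extend P \<in> B.cauchy_completion"
      unfolding st extend_cauchy_class[OF st(1)] by (intro B.cauchy_class_in MCauchy_comp st)
    have M: "s n \<in> M" "t n \<in> M" for n using st by (auto simp: A.MCauchy_def)
    show "B.completion_dist (extend P) (extend Q) \<le> K * A.completion_dist P Q"
      unfolding st extend_cauchy_class[OF st(1)] extend_cauchy_class[OF st(3)]
      by (rule LIMSEQ_le[OF B.completion_dist_class[OF MCauchy_comp[OF st(1)] MCauchy_comp[OF st(3)]]
            tendsto_mult_left[OF A.completion_dist_class[OF st(1,3)]]])
        (use lipschitz M in auto)
  qed
  have "Lipschitz_continuous_map (metric (A.cauchy_completion, A.completion_dist))
      (metric (B.cauchy_completion, B.completion_dist)) extend"
    unfolding Lipschitz_continuous_map_def
    using lip cl by (auto simp: CA.mspace_metric CA.mdist_metric CB.mspace_metric CB.mdist_metric)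
  then show ?thesis
    using Lipschitz_continuous_imp_continuous_map by (fastforce simp: CA.mtopology_of CB.mtopology_of)
qed

end

section \<open>Mutually inverse boundary maps and the homeomorphism of glueings\<close>

text \<open>The two composites are only asked to approach the identity along escaping sequences,
  which is what the boundary sees. The condition \<open>reflects\<close> guarantees escape of a
  sequence of which only the image under \<open>\<pi>\<close> is known to escape.\<close>

locale coarse_inverse =
  P: height_map M2 d2 N2 M1 d1 N1 \<pi> K + R: height_map M1 d1 N1 M2 d2 N2 \<rho> K'
  for M1 :: "'a set" and d1 N1 and M2 :: "'b set" and d2 N2 and \<pi> K \<rho> K' +
  assumes left: "range s \<subseteq> M2 \<Longrightarrow> filterlim (\<lambda>n. N2 (s n)) at_top sequentially \<Longrightarrow>
      (\<lambda>n. d2 (\<rho> (\<pi> (s n))) (s n)) \<longlonglongrightarrow> 0"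
    and right: "range t \<subseteq> M1 \<Longrightarrow> filterlim (\<lambda>n. N1 (t n)) at_top sequentially \<Longrightarrow>
      (\<lambda>n. d1 (\<pi> (\<rho> (t n))) (t n)) \<longlonglongrightarrow> 0"
    and reflects: "range s \<subseteq> M2 \<Longrightarrow> filterlim (\<lambda>n. N1 (\<pi> (s n))) at_top sequentially \<Longrightarrow>
      filterlim (\<lambda>n. N2 (s n)) at_top sequentially"
begin

interpretation C1: Metric_space P.B.cauchy_completion P.B.completion_dist
  by (rule P.B.Metric_space_cauchy_completion)

interpretation C2: Metric_space P.A.cauchy_completion P.A.completion_dist
  by (rule P.A.Metric_space_cauchy_completion)

text \<open>A boundary point has an escaping representative \<open>t\<close>, and
  \<open>right\<close> says that \<open>\<pi> \<circ> \<rho> \<circ> t\<close> represents the same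
  class.\<close>

lemma extend_right_inverse:
  assumes "Q \<in> P.B.boundary"
  shows "P.extend (R.extend Q) = Q"
proof -
  obtain t where t: "P.B.MCauchy t" "Q = P.B.cauchy_class t" "filterlim (\<lambda>n. N1 (t n)) at_top sequentially"
    using assms by (rule P.B.boundaryE)
  have "range t \<subseteq> M1" using t(1) by (simp add: P.B.MCauchy_def)
  then show ?thesis
    using right[of t] t(3) unfolding t(2) R.extend_cauchy_class[OF t(1)]
      P.extend_cauchy_class[OF R.MCauchy_comp[OF t(1)]]
      P.B.cauchy_class_eq_iff[OF P.MCauchy_comp[OF R.MCauchy_comp[OF t(1)]] t(1)] by simp
qed

lemma extend_left_inverse:
  assumes "Q \<in> P.A.boundary"
  shows "R.extend (P.extend Q) = Q"
proof -
  obtain s where s: "P.A.MCauchy s" "Q = P.A.cauchy_class s" "filterlim (\<lambda>n. N2 (s n)) at_top sequentially"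
    using assms by (rule P.A.boundaryE)
  have "range s \<subseteq> M2" using s(1) by (simp add: P.A.MCauchy_def)
  then show ?thesis
    using left[of s] s(3) unfolding s(2) P.extend_cauchy_class[OF s(1)]
      R.extend_cauchy_class[OF P.MCauchy_comp[OF s(1)]]
      P.A.cauchy_class_eq_iff[OF R.MCauchy_comp[OF P.MCauchy_comp[OF s(1)]] s(1)] by simp
qed

lemma remainder_eq:
  "remainder (discrete_topology M1) C1.mtopology P.B.completion_embed = subtopology C1.mtopology P.B.boundary"
  "remainder (discrete_topology M2) C2.mtopology P.A.completion_embed = subtopology C2.mtopology P.A.boundary"
  by (simp_all add: remainder_def P.A.boundary_def P.B.boundary_def)

text \<open>\<open>Pi_functor\<close> keeps the boundary of \<open>M1\<close> while replacing
  \<open>M1\<close> by \<open>M2\<close>. Hence the map wanted on boundaries is the extension of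
  \<open>\<rho>\<close>, with that of \<open>\<pi>\<close> as inverse.\<close>

lemma homeomorphic_map_remainder:
  "homeomorphic_map (remainder (discrete_topology M1) C1.mtopology P.B.completion_embed)
     (remainder (discrete_topology M2) C2.mtopology P.A.completion_embed) R.extend"
proof -
  have "homeomorphic_maps (subtopology C1.mtopology P.B.boundary) (subtopology C2.mtopology P.A.boundary)
      R.extend P.extend"
    unfolding homeomorphic_maps_def
    using extend_left_inverse extend_right_inverse R.extend_boundary P.extend_boundary
    by (intro conjI continuous_map_into_subtopology continuous_map_from_subtopology
        R.continuous_map_extend P.continuous_map_extend) auto
  then show ?thesis unfolding remainder_eq by (rule homeomorphic_maps_imp_map)
qed

lemma extend_remainder_map:
  assumes A: "A \<subseteq> M2"
  shows "R.extend ` remainder_map (discrete_topology M1) C1.mtopology P.B.completion_embed (\<pi> ` A) =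
    remainder_map (discrete_topology M2) C2.mtopology P.A.completion_embed A"
proof -
  have pA: "\<pi> ` A \<subseteq> M1" using A P.map_in by auto
  have r1: "remainder_map (discrete_topology M1) C1.mtopology P.B.completion_embed (\<pi> ` A) =
      C1.mtopology closure_of (P.B.completion_embed ` \<pi> ` A) \<inter> P.B.boundary"
    using closure_of_subset_topspace[of C1.mtopology] by (fastforce simp: remainder_map_def P.B.boundary_def)
  have r2: "remainder_map (discrete_topology M2) C2.mtopology P.A.completion_embed A =
      C2.mtopology closure_of (P.A.completion_embed ` A) \<inter> P.A.boundary"
    using closure_of_subset_topspace[of C2.mtopology] by (fastforce simp: remainder_map_def P.A.boundary_def)
  show ?thesis unfolding r1 r2
  proof
    show "R.extend ` (C1.mtopology closure_of (P.B.completion_embed ` \<pi> ` A) \<inter> P.B.boundary)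
        \<subseteq> C2.mtopology closure_of (P.A.completion_embed ` A) \<inter> P.A.boundary"
    proof (rule image_subsetI, elim IntE)
      fix Q assume "Q \<in> C1.mtopology closure_of (P.B.completion_embed ` \<pi> ` A)" and Q: "Q \<in> P.B.boundary"
      then obtain t where t: "P.B.MCauchy t" "range t \<subseteq> \<pi> ` A" "Q = P.B.cauchy_class t"
        using P.B.closure_of_completion_embed_iff[OF pA] by auto
      then have "\<forall>n. \<exists>a. a \<in> A \<and> t n = \<pi> a" by blast
      \<comment> \<open>An arbitrary lift of \<open>t\<close> to \<open>A\<close> need not be Cauchy
        on the face of it; this follows below because \<open>a\<close> is asymptotic to the Cauchy
        sequence \<open>\<rho> \<circ> t\<close>.\<close>
      then obtain a where a: "\<And>n. a n \<in> A" "\<And>n. t n = \<pi> (a n)" by metis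
      have aM: "range a \<subseteq> M2" using a A by auto
      have "filterlim (\<lambda>n. N1 (\<pi> (a n))) at_top sequentially"
        using P.B.cauchy_class_in_boundary_iff[OF t(1)] t(3) Q a(2) by simp
      then have near: "(\<lambda>n. d2 (\<rho> (t n)) (a n)) \<longlonglongrightarrow> 0"
        using left[OF aM] reflects[OF aM] a(2) by simp
      have lim: "limitin C2.mtopology (\<lambda>n. P.A.completion_embed (\<rho> (t n))) (R.extend Q) sequentially"
        using P.A.limitin_cauchy_class[OF R.MCauchy_comp[OF t(1)]]
        by (simp add: t(3) R.extend_cauchy_class[OF t(1)])
      have tM: "\<rho> (t n) \<in> M2" "a n \<in> M2" for n using aM a(2) P.map_in R.map_in by auto
      have "limitin C2.mtopology (\<lambda>n. P.A.completion_embed (a n)) (R.extend Q) sequentially"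
        unfolding C2.limitin_metric_dist_null
      proof (intro conjI always_eventually allI P.A.completion_embed_in tM)
        note l = lim[unfolded C2.limitin_metric_dist_null]
        show RQ: "R.extend Q \<in> P.A.cauchy_completion" using l by simp
        show "(\<lambda>n. P.A.completion_dist (P.A.completion_embed (a n)) (R.extend Q)) \<longlonglongrightarrow> 0"
        proof (rule Lim_null_comparison)
          show "(\<lambda>n. d2 (\<rho> (t n)) (a n) +
              P.A.completion_dist (P.A.completion_embed (\<rho> (t n))) (R.extend Q)) \<longlonglongrightarrow> 0"
            using tendsto_add[OF near] l by fastforce
          show "\<forall>\<^sub>F n in sequentially. norm (P.A.completion_dist (P.A.completion_embed (a n)) (R.extend Q))
              \<le> d2 (\<rho> (t n)) (a n) + P.A.completion_dist (P.A.completion_embed (\<rho> (t n))) (R.extend Q)"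
          proof (intro always_eventually allI)
            fix n
            show "norm (P.A.completion_dist (P.A.completion_embed (a n)) (R.extend Q))
              \<le> d2 (\<rho> (t n)) (a n) + P.A.completion_dist (P.A.completion_embed (\<rho> (t n))) (R.extend Q)"
              using C2.triangle[OF P.A.completion_embed_in[OF tM(2)[of n]]
                  P.A.completion_embed_in[OF tM(1)[of n]] RQ]
              by (simp add: P.A.completion_dist_embed[OF tM(2,1)] P.A.commute)
          qed
        qed
      qed
      then have "P.A.MCauchy a" "R.extend Q = P.A.cauchy_class a"
        using P.A.limitin_completion_embedD[OF aM] by auto
      then show "R.extend Q \<in> C2.mtopology closure_of (P.A.completion_embed ` A) \<inter> P.A.boundary"
        using P.A.closure_of_completion_embed_iff[OF A] a(1) R.extend_boundary[OF Q] by blast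
    qed
    show "C2.mtopology closure_of (P.A.completion_embed ` A) \<inter> P.A.boundary
        \<subseteq> R.extend ` (C1.mtopology closure_of (P.B.completion_embed ` \<pi> ` A) \<inter> P.B.boundary)"
    proof (rule subsetI, elim IntE)
      fix Q assume "Q \<in> C2.mtopology closure_of (P.A.completion_embed ` A)" and Q: "Q \<in> P.A.boundary"
      then obtain s where s: "P.A.MCauchy s" "range s \<subseteq> A" "Q = P.A.cauchy_class s"
        using P.A.closure_of_completion_embed_iff[OF A] by auto
      \<comment> \<open>The preimage of \<open>Q\<close> under \<open>R.extend\<close> is
        \<open>P.extend Q\<close>, represented by \<open>\<pi> \<circ> s\<close>.\<close>
      have "P.extend Q \<in> C1.mtopology closure_of (P.B.completion_embed ` \<pi> ` A)"
        unfolding P.B.closure_of_completion_embed_iff[OF pA] s(3) P.extend_cauchy_class[OF s(1)]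
        using P.MCauchy_comp[OF s(1)] s(2) by (intro exI[of _ "\<pi> \<circ> s"]) auto
      then show "Q \<in> R.extend ` (C1.mtopology closure_of (P.B.completion_embed ` \<pi> ` A) \<inter> P.B.boundary)"
        using extend_left_inverse[OF Q] P.extend_boundary[OF Q] by (metis IntI image_eqI)
    qed
  qed
qed

text \<open>The boundary homeomorphism is glued to the identity of \<open>M2\<close>, and the result
  is composed with the identification of the second completion with its own glueing.\<close>

lemma homeomorphic_map_Pi_functor:
  assumes o1: "openin C1.mtopology (P.B.completion_embed ` M1)"
    and o2: "openin C2.mtopology (P.A.completion_embed ` M2)"
    and e2: "embedding_map (discrete_topology M2) C2.mtopology P.A.completion_embed"
  shows "homeomorphic_map
    (Pi_functor (discrete_topology M1) (discrete_topology M2) \<pi> C1.mtopology P.B.completion_embed)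
    C2.mtopology (case_sum P.A.completion_embed R.extend)"
proof -
  let ?X1 = "discrete_topology M1" and ?X2 = "discrete_topology M2"
  have a1: "admissible_map ?X1 (remainder ?X1 C1.mtopology P.B.completion_embed)
      (remainder_map ?X1 C1.mtopology P.B.completion_embed)"
    using o1 by (intro admissible_remainder_map) simp
  have a2: "admissible_map ?X2 (remainder ?X2 C2.mtopology P.A.completion_embed)
      (remainder_map ?X2 C2.mtopology P.A.completion_embed)"
    using o2 by (intro admissible_remainder_map) simp
  \<comment> \<open>In a discrete space closure amounts to intersection with the carrier, so the
    closure in \<open>pullback_map\<close> disappears.\<close>
  have pA: "M1 \<inter> \<pi> ` A = \<pi> ` A" if "A \<subseteq> M2" for A using that P.map_in by blast
  have "homeomorphic_map (Pi_functor ?X1 ?X2 \<pi> C1.mtopology P.B.completion_embed)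
      (glueing ?X2 (remainder ?X2 C2.mtopology P.A.completion_embed)
        (remainder_map ?X2 C2.mtopology P.A.completion_embed)) (map_sum id R.extend)"
    unfolding Pi_functor_def
  proof (rule homeomorphic_map_glueing[OF admissible_pullback_map[OF a1] a2 homeomorphic_map_remainder])
    fix A assume "closedin ?X2 A"
    then have "A \<subseteq> M2" by simp
    then show "R.extend ` pullback_map ?X1 \<pi> (remainder_map ?X1 C1.mtopology P.B.completion_embed) A =
        remainder_map ?X2 C2.mtopology P.A.completion_embed A"
      by (simp add: pullback_map_def discrete_topology_closure_of pA extend_remainder_map)
  qed
  moreover have "homeomorphic_map (glueing ?X2 (remainder ?X2 C2.mtopology P.A.completion_embed)
        (remainder_map ?X2 C2.mtopology P.A.completion_embed)) C2.mtopology
      (case_sum P.A.completion_embed id)"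
    using o2 by (intro homeomorphic_map_glueing_remainder e2) simp
  ultimately have "homeomorphic_map (Pi_functor ?X1 ?X2 \<pi> C1.mtopology P.B.completion_embed)
      C2.mtopology (case_sum P.A.completion_embed id \<circ> map_sum id R.extend)"
    by (rule homeomorphic_map_compose)
  moreover have "case_sum P.A.completion_embed id \<circ> map_sum id R.extend =
      case_sum P.A.completion_embed R.extend"
    by (auto simp: fun_eq_iff split: sum.split)
  ultimately show ?thesis by simp
qed

end


section \<open>Comparing Floyd metrics\<close>

lemma graph_dist_le:
  assumes "p \<in> paths V E x y"
  shows "graph_dist V E x y \<le> length p - 1"
  unfolding graph_dist_def using assms by (intro cINF_lower) auto

lemma graph_dist_attained:
  assumes "connected_graph V E" "x \<in> V" "y \<in> V"
  obtains p where "p \<in> paths V E x y" "length p - 1 = graph_dist V E x y"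
proof -
  have "(\<lambda>p. length p - 1) ` paths V E x y \<noteq> {}" using assms by (auto simp: connected_graph_def)
  from Inf_nat_def1[OF this] show ?thesis using that by (auto simp: graph_dist_def)
qed

lemma graph_dist_triangle:
  assumes c: "connected_graph V E" and xyz: "x \<in> V" "y \<in> V" "z \<in> V"
  shows "graph_dist V E x z \<le> graph_dist V E x y + graph_dist V E y z"
proof -
  obtain p where p: "p \<in> paths V E x y" "length p - 1 = graph_dist V E x y"
    using graph_dist_attained[OF c xyz(1,2)] .
  obtain q where q: "q \<in> paths V E y z" "length q - 1 = graph_dist V E y z"
    using graph_dist_attained[OF c xyz(2,3)] .
  have "p \<noteq> []" "q \<noteq> []" using p q by (auto simp: paths_def)
  then have "length (p @ tl q) - 1 = graph_dist V E x y + graph_dist V E y z"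
    using p(2) q(2) by (cases p; cases q) auto
  then show ?thesis using graph_dist_le[OF paths_append(1)[OF p(1) q(1)]] by simp
qed

text \<open>Applied to a shortest path, this bounds the distance from each of its vertices to the
  end point.\<close>

lemma paths_drop:
  assumes p: "p \<in> paths V E x y" and i: "i < length p"
  shows "drop i p \<in> paths V E (p ! i) y"
proof -
  have "successively E (drop i p)"
    using p append_take_drop_id[of i p] unfolding paths_def by (metis (mono_tags, lifting) mem_Collect_eq successively_append_iff)
  then show ?thesis using p i set_drop_subset[of i p]
    by (auto simp: paths_def hd_drop_conv_nth)
qed

lemma floyd_dist_le:
  assumes "floyd_map f" "p \<in> paths V E x y"
  shows "floyd_dist V E f v x y \<le> floyd_length V E f v p"
proof -
  have "x \<in> V" "y \<in> V" using assms(2) by (auto simp: paths_def)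
  then show ?thesis
    unfolding floyd_dist_def using floyd_length_nonneg[OF assms(1)] assms(2)
    by (auto intro!: cINF_lower bdd_belowI[of _ 0])
qed

text \<open>Iterating the bound \<open>k\<close> on consecutive ratios \<open>L\<close> times gives
  \<open>C = k ^ L\<close>.\<close>

lemma floyd_map_shift:
  assumes f: "floyd_map f"
  obtains C where "\<And>n. f (n - L) \<le> C * f n"
proof -
  obtain k where k: "k > 0" "\<And>n. 1 \<le> f n / f (Suc n)" "\<And>n. f n / f (Suc n) \<le> k"
    and pos: "\<And>n. f n > 0"
    using f unfolding floyd_map_def by blast
  have k1: "k \<ge> 1" using k(2,3) order_trans by blast
  have "f (n - L) \<le> k ^ L * f n" for n
  proof (induction L)
    case (Suc L)
    have "f (n - Suc L) \<le> k * f (n - L)"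
    proof (cases "n - L")
      \<comment> \<open>Subtraction is truncated, so both arguments are \<open>0\<close> here and
        \<open>k \<ge> 1\<close> suffices.\<close>
      case 0
      then show ?thesis using k1 pos[of 0] by simp
    next
      case (Suc m)
      then have "n - Suc L = m" by simp
      with Suc k(3)[of m] pos[of "Suc m"] show ?thesis by (simp add: divide_le_eq)
    qed
    also have "\<dots> \<le> k * (k ^ L * f n)" using Suc k(1) by (intro mult_left_mono) auto
    finally show ?case by simp
  qed simp
  then show ?thesis by (rule that)
qed

text \<open>A shortest path from \<open>x\<close> to \<open>y\<close> has at most \<open>L\<close>
  edges, and its vertices lie at height at least that of \<open>y\<close> minus \<open>L\<close>.
  Each edge therefore weighs at most a constant times \<open>f\<close> at the height of
  \<open>y\<close>.\<close>

lemma floyd_dist_bounded_distance: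
  assumes g: "graph V E" and c: "connected_graph V E" and f: "floyd_map f" and v: "v \<in> V"
  obtains C where "C \<ge> 0"
    "\<And>x y. x \<in> V \<Longrightarrow> y \<in> V \<Longrightarrow> graph_dist V E x y \<le> L \<Longrightarrow>
      floyd_dist V E f v x y \<le> C * f (graph_dist V E v y)"
proof -
  obtain C where C: "\<And>n. f (n - L) \<le> C * f n" by (rule floyd_map_shift[OF f, of L]) blast
  have pos: "f n > 0" for n using f by (simp add: floyd_map_def)
  have "0 < C * f 0" using C[of 0] pos[of "0 - L"] by linarith
  then have C0: "C > 0" using pos[of 0] by (simp add: zero_less_mult_iff)
  have "floyd_dist V E f v x y \<le> L * C * f (graph_dist V E v y)"
    if xy: "x \<in> V" "y \<in> V" and L: "graph_dist V E x y \<le> L" for x y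
  proof -
    obtain p where p: "p \<in> paths V E x y" "length p - 1 = graph_dist V E x y"
      using graph_dist_attained[OF c xy] .
    have near: "graph_dist V E v y - L \<le> graph_dist V E v (p ! i)" if i: "i < length p" for i
    proof -
      have "p ! i \<in> V" using p(1) i by (auto simp: paths_def)
      then have "graph_dist V E v y \<le> graph_dist V E v (p ! i) + graph_dist V E (p ! i) y"
        using graph_dist_triangle[OF c v _ xy(2)] by blast
      moreover have "graph_dist V E (p ! i) y \<le> L"
        using graph_dist_le[OF paths_drop[OF p(1) i]] p(2) L by simp
      ultimately show ?thesis by simp
    qed
    have "floyd_length V E f v p \<le> (\<Sum>i<length p - 1. C * f (graph_dist V E v y))"
      unfolding floyd_length_def
    proof (rule sum_mono)
      fix i assume "i \<in> {..<length p - 1}"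
      then have "graph_dist V E v y - L \<le> min (graph_dist V E v (p ! i)) (graph_dist V E v (p ! Suc i))"
        using near[of i] near[of "Suc i"] by simp
      then show "f (min (graph_dist V E v (p ! i)) (graph_dist V E v (p ! Suc i))) \<le> C * f (graph_dist V E v y)"
        using floyd_map_antimono[OF f] C order_trans by blast
    qed
    also have "\<dots> = (length p - 1) * (C * f (graph_dist V E v y))" by simp
    also have "\<dots> \<le> L * (C * f (graph_dist V E v y))"
      using p(2) L C0 pos[of "graph_dist V E v y"] by (intro mult_right_mono) auto
    finally show ?thesis using floyd_dist_le[OF f p(1), of v] by (simp add: mult.assoc)
  qed
  then show ?thesis using that[of "L * C"] C0 by simp
qed

lemma floyd_length_Cons_Cons:
  "floyd_length V E f v (x # y # p) =
    f (min (graph_dist V E v x) (graph_dist V E v y)) + floyd_length V E f v (y # p)"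
  unfolding floyd_length_def by (simp add: sum.lessThan_Suc_shift del: sum.lessThan_Suc)

text \<open>The triangle inequality adds the bounds on edges along any path, and taking the infimum
  over paths yields the Floyd distance.\<close>

lemma floyd_dist_lipschitz_from_edges:
  assumes m: "Metric_space M d" and c: "connected_graph V E" and f: "floyd_map f"
    and C: "C \<ge> 0" and \<phi>: "\<And>x. x \<in> V \<Longrightarrow> \<phi> x \<in> M"
    and edge: "\<And>x y. x \<in> V \<Longrightarrow> y \<in> V \<Longrightarrow> E x y \<Longrightarrow>
      d (\<phi> x) (\<phi> y) \<le> C * f (min (graph_dist V E v x) (graph_dist V E v y))"
    and xy: "x \<in> V" "y \<in> V"
  shows "d (\<phi> x) (\<phi> y) \<le> C * floyd_dist V E f v x y"
proof -
  interpret Metric_space M d by fact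
  have path: "d (\<phi> x) (\<phi> y) \<le> C * floyd_length V E f v p" if "p \<in> paths V E x y" for p x
    using that
  proof (induction p arbitrary: x)
    case (Cons a p)
    then have a: "a = x" "x \<in> V" by (auto simp: paths_def)
    show ?case
    proof (cases p)
      case Nil
      then have "y = x" using Cons.prems by (auto simp: paths_def)
      then show ?thesis using \<phi>[OF a(2)] C floyd_length_nonneg[OF f, of V E v "a # p"] by simp
    next
      case p: (Cons b q)
      have b: "b \<in> V" "E x b" "p \<in> paths V E b y" "y \<in> V"
        using Cons.prems unfolding paths_def p a(1) by (auto split: if_splits)
      have "d (\<phi> x) (\<phi> y) \<le> d (\<phi> x) (\<phi> b) + d (\<phi> b) (\<phi> y)" using triangle \<phi> a b by blast
      also have "\<dots> \<le> C * f (min (graph_dist V E v x) (graph_dist V E v b)) + C * floyd_length V E f v p"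
        using edge[OF a(2) b(1,2)] Cons.IH[OF b(3)] by (rule add_mono)
      finally show ?thesis unfolding p a(1) floyd_length_Cons_Cons by (simp add: distrib_left)
    qed
  qed (simp add: paths_def)
  have ne: "paths V E x y \<noteq> {}" using c xy by (simp add: connected_graph_def)
  show ?thesis
  \<comment> \<open>Dividing by \<open>C\<close> brings the bound under the infimum, so the value
    \<open>0\<close> is treated apart.\<close>
  proof (cases "C = 0")
    case True
    then show ?thesis using path ne by fastforce
  next
    case False
    then have "d (\<phi> x) (\<phi> y) / C \<le> floyd_length V E f v p" if "p \<in> paths V E x y" for p
      using path[OF that] C by (simp add: divide_le_eq mult.commute)
    then have "d (\<phi> x) (\<phi> y) / C \<le> floyd_dist V E f v x y"
      using xy ne by (auto simp: floyd_dist_def intro!: cINF_greatest)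
    then show ?thesis using C False by (simp add: divide_le_eq mult.commute)
  qed
qed

section \<open>Quasi-isometric maps between Floyd metrics\<close>

text \<open>Wherever \<open>t\<close> is below \<open>R\<close>, \<open>s\<close> is at most
  \<open>h R\<close>. With \<open>h\<close> built from \<alpha> this serves both to show that
  escaping sequences are preserved and that they are reflected.\<close>

lemma filterlim_at_top_nat_reflect:
  fixes s t :: "'c \<Rightarrow> nat" and h :: "nat \<Rightarrow> nat"
  assumes h: "mono h" and le: "\<And>x. s x \<le> h (t x)" and s: "filterlim s at_top F"
  shows "filterlim t at_top F"
  unfolding filterlim_at_top
proof
  fix R
  have "\<forall>\<^sub>F x in F. Suc (h R) \<le> s x" using s by (simp add: filterlim_at_top)
  then show "\<forall>\<^sub>F x in F. R \<le> t x"
  proof eventually_elim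
    case (elim x)
    show ?case
    proof (rule ccontr)
      assume "\<not> R \<le> t x"
      then have "h (t x) \<le> h R" by (intro monoD[OF h]) simp
      then show False using le[of x] elim by linarith
    qed
  qed
qed

text \<open>The base point \<open>v1\<close> may differ from \<open>\<pi> v2\<close>; the triangle
  inequality puts their distance outside \<alpha> in one estimate and inside it in the
  other.\<close>

lemma quasi_isometric_base_points:
  assumes g1: "connected_graph V1 E1" and g2: "connected_graph V2 E2"
    and q: "quasi_isometric \<alpha> V2 (graph_dist V2 E2) V1 (graph_dist V1 E1) \<pi>" and \<alpha>: "mono \<alpha>"
    and v: "v1 \<in> V1" "v2 \<in> V2" and x: "x \<in> V2"
  shows "graph_dist V1 E1 v1 (\<pi> x) \<le> graph_dist V1 E1 v1 (\<pi> v2) + \<alpha> (graph_dist V2 E2 v2 x)"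
    and "graph_dist V2 E2 v2 x \<le> \<alpha> (graph_dist V1 E1 (\<pi> v2) v1 + graph_dist V1 E1 v1 (\<pi> x))"
proof -
  have \<pi>: "\<pi> x \<in> V1" "\<pi> v2 \<in> V1"
    and le: "graph_dist V1 E1 (\<pi> v2) (\<pi> x) \<le> \<alpha> (graph_dist V2 E2 v2 x)"
      "graph_dist V2 E2 v2 x \<le> \<alpha> (graph_dist V1 E1 (\<pi> v2) (\<pi> x))"
    using q v x by (auto simp: quasi_isometric_def)
  show "graph_dist V1 E1 v1 (\<pi> x) \<le> graph_dist V1 E1 v1 (\<pi> v2) + \<alpha> (graph_dist V2 E2 v2 x)"
    using graph_dist_triangle[OF g1 v(1) \<pi>(2,1)] le(1) by linarith
  show "graph_dist V2 E2 v2 x \<le> \<alpha> (graph_dist V1 E1 (\<pi> v2) v1 + graph_dist V1 E1 v1 (\<pi> x))"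
    using le(2) monoD[OF \<alpha> graph_dist_triangle[OF g1 \<pi>(2) v(1) \<pi>(1)]] by linarith
qed

text \<open>It suffices to treat edges. The growth hypothesis compares \<open>f1\<close> with
  \<open>f2\<close> at related heights, and the images of adjacent vertices are at distance at most
  \<open>\<alpha> 1\<close>.\<close>

lemma quasi_isometric_floyd_lipschitz:
  assumes g1: "graph V1 E1" "connected_graph V1 E1" and g2: "graph V2 E2" "connected_graph V2 E2"
    and f: "floyd_map f1" "floyd_map f2" and \<alpha>: "mono \<alpha>"
    and q: "quasi_isometric \<alpha> V2 (graph_dist V2 E2) V1 (graph_dist V1 E1) \<pi>"
    and D: "\<And>n. f1 n / f2 (\<alpha> n) \<le> D"
    and v: "v1 \<in> V1" "v2 \<in> V2"
  obtains C where "\<And>x y. x \<in> V2 \<Longrightarrow> y \<in> V2 \<Longrightarrow>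
    floyd_dist V1 E1 f1 v1 (\<pi> x) (\<pi> y) \<le> C * floyd_dist V2 E2 f2 v2 x y"
proof -
  have \<pi>: "\<pi> x \<in> V1" if "x \<in> V2" for x using q that by (auto simp: quasi_isometric_def)
  have pos: "f1 n > 0" "f2 n > 0" for n using f by (simp_all add: floyd_map_def)
  have "0 < f1 0 / f2 (\<alpha> 0)" using pos by simp
  then have D0: "D > 0" using D[of 0] by linarith
  have Df: "f1 n \<le> D * f2 (\<alpha> n)" for n using D[of n] pos(2)[of "\<alpha> n"] by (simp add: divide_le_eq)
  let ?L = "graph_dist V1 E1 (\<pi> v2) v1"
  obtain B where B: "\<And>n. f1 (n - ?L) \<le> B * f1 n" by (rule floyd_map_shift[OF f(1), of ?L]) blast
  have "0 < B * f1 0" using B[of 0] pos(1)[of "0 - ?L"] by linarith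
  then have B0: "B > 0" using pos(1)[of 0] by (simp add: zero_less_mult_iff)
  \<comment> \<open>The factor \<open>B\<close> pays for moving the base point by \<open>?L\<close>,
    and \<open>D\<close> for passing from \<open>f1\<close> at \<open>?n\<close> to
    \<open>f2\<close> at \<open>\<alpha> ?n\<close>, which is at least the height of
    \<open>x\<close>.\<close>
  have f12: "f1 (graph_dist V1 E1 v1 (\<pi> x)) \<le> B * D * f2 (graph_dist V2 E2 v2 x)" if x: "x \<in> V2" for x
  proof -
    let ?n = "graph_dist V1 E1 v1 (\<pi> x) + ?L"
    have "f1 (graph_dist V1 E1 v1 (\<pi> x)) \<le> B * f1 ?n" using B[of ?n] by simp
    also have "\<dots> \<le> B * (D * f2 (\<alpha> ?n))" using B0 Df by (intro mult_left_mono) auto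
    also have "\<dots> \<le> B * (D * f2 (graph_dist V2 E2 v2 x))"
      using quasi_isometric_base_points(2)[OF g1(2) g2(2) q \<alpha> v x] B0 D0
      by (intro mult_left_mono floyd_map_antimono[OF f(2)]) (auto simp: add.commute)
    finally show ?thesis by simp
  qed
  obtain C where C: "C \<ge> 0" "\<And>x y. x \<in> V1 \<Longrightarrow> y \<in> V1 \<Longrightarrow> graph_dist V1 E1 x y \<le> \<alpha> 1 \<Longrightarrow>
      floyd_dist V1 E1 f1 v1 x y \<le> C * f1 (graph_dist V1 E1 v1 y)"
    by (rule floyd_dist_bounded_distance[OF g1 f(1) v(1), of "\<alpha> 1"]) blast
  have "floyd_dist V1 E1 f1 v1 (\<pi> x) (\<pi> y) \<le>
      (C * (B * D)) * f2 (min (graph_dist V2 E2 v2 x) (graph_dist V2 E2 v2 y))"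
    if xy: "x \<in> V2" "y \<in> V2" and "E2 x y" for x y
  proof -
    have "[x, y] \<in> paths V2 E2 x y" using that by (simp add: paths_def)
    then have "graph_dist V2 E2 x y \<le> 1" using graph_dist_le by fastforce
    then have "graph_dist V1 E1 (\<pi> x) (\<pi> y) \<le> \<alpha> 1"
      using q xy monoD[OF \<alpha>] unfolding quasi_isometric_def by (meson order_trans)
    then have "floyd_dist V1 E1 f1 v1 (\<pi> x) (\<pi> y) \<le> C * f1 (graph_dist V1 E1 v1 (\<pi> y))"
      using C(2) \<pi> xy by blast
    also have "\<dots> \<le> C * (B * D * f2 (graph_dist V2 E2 v2 y))"
      using f12[OF xy(2)] C(1) by (rule mult_left_mono)
    \<comment> \<open>\<open>f2\<close> is nonincreasing, so replacing the height of
      \<open>y\<close> by the smaller height only enlarges the bound.\<close>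
    also have "\<dots> \<le> C * (B * D * f2 (min (graph_dist V2 E2 v2 x) (graph_dist V2 E2 v2 y)))"
      using C(1) B0 D0 by (intro mult_left_mono floyd_map_antimono[OF f(2)]) auto
    finally show ?thesis by (simp add: mult.assoc)
  qed
  moreover have "0 \<le> C * (B * D)" using C(1) B0 D0 by simp
  ultimately have "floyd_dist V1 E1 f1 v1 (\<pi> x) (\<pi> y) \<le> (C * (B * D)) * floyd_dist V2 E2 f2 v2 x y"
    if "x \<in> V2" "y \<in> V2" for x y
    using floyd_dist_lipschitz_from_edges[OF Metric_space_floyd_dist[OF g1 f(1)] g2(2) f(2), of _ \<pi>] \<pi> that
    by blast
  then show ?thesis by (rule that)
qed

text \<open>A nontrivial path from a vertex of height at most \<open>n\<close> starts with an edge
  of weight at least \<open>f n\<close>, which is the isolation radius.\<close>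

lemma height_space_floyd:
  assumes "graph V E" "connected_graph V E" "floyd_map f"
  shows "height_space V (floyd_dist V E f v) (graph_dist V E v)"
proof -
  interpret Metric_space V "floyd_dist V E f v" by (rule Metric_space_floyd_dist[OF assms])
  show ?thesis
  proof
    fix n
    have "f n \<le> floyd_dist V E f v x y"
      if "x \<in> V" "y \<in> V" "x \<noteq> y" "graph_dist V E v x \<le> n" for x y
      using floyd_dist_isolated[OF assms(3,2) that(1-3), of v] floyd_map_antimono[OF assms(3) that(4)]
      by linarith
    moreover have "f n > 0" using assms(3) by (simp add: floyd_map_def)
    ultimately show "\<exists>e>0. \<forall>x\<in>V. \<forall>y\<in>V. graph_dist V E v x \<le> n \<longrightarrow> x \<noteq> y \<longrightarrow> e \<le> floyd_dist V E f v x y"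
      by blast
  qed
qed

text \<open>Only one map and one growth bound enter, so exchanging the two graphs covers the
  quasi-inverse as well.\<close>

lemma height_map_quasi_isometric:
  assumes g1: "graph V1 E1" "connected_graph V1 E1" and g2: "graph V2 E2" "connected_graph V2 E2"
    and f: "floyd_map f1" "floyd_map f2" and \<alpha>: "mono \<alpha>"
    and q: "quasi_isometric \<alpha> V2 (graph_dist V2 E2) V1 (graph_dist V1 E1) \<pi>"
    and D: "\<And>n. f1 n / f2 (\<alpha> n) \<le> D"
    and v: "v1 \<in> V1" "v2 \<in> V2"
  obtains C where "height_map V2 (floyd_dist V2 E2 f2 v2) (graph_dist V2 E2 v2)
    V1 (floyd_dist V1 E1 f1 v1) (graph_dist V1 E1 v1) \<pi> C"
proof -
  obtain C where C: "\<And>x y. x \<in> V2 \<Longrightarrow> y \<in> V2 \<Longrightarrow>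
      floyd_dist V1 E1 f1 v1 (\<pi> x) (\<pi> y) \<le> C * floyd_dist V2 E2 f2 v2 x y"
    by (rule quasi_isometric_floyd_lipschitz[OF g1 g2 f \<alpha> q D v]) blast
  have "height_map V2 (floyd_dist V2 E2 f2 v2) (graph_dist V2 E2 v2)
      V1 (floyd_dist V1 E1 f1 v1) (graph_dist V1 E1 v1) \<pi> C"
  proof (intro height_map.intro height_map_axioms.intro height_space_floyd g1 g2 f C)
    show "\<pi> x \<in> V1" if "x \<in> V2" for x using q that by (auto simp: quasi_isometric_def)
    fix s :: "nat \<Rightarrow> _" assume s: "range s \<subseteq> V2"
      and lim: "filterlim (\<lambda>n. graph_dist V2 E2 v2 (s n)) at_top sequentially"
    show "filterlim (\<lambda>n. graph_dist V1 E1 v1 (\<pi> (s n))) at_top sequentially"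
    proof (rule filterlim_at_top_nat_reflect[OF _ _ lim])
      show "mono (\<lambda>n. \<alpha> (graph_dist V1 E1 (\<pi> v2) v1 + n))"
        by (intro monoI monoD[OF \<alpha>]) simp
      show "graph_dist V2 E2 v2 (s n) \<le>
          \<alpha> (graph_dist V1 E1 (\<pi> v2) v1 + graph_dist V1 E1 v1 (\<pi> (s n)))" for n
        using s by (intro quasi_isometric_base_points(2)[OF g1(2) g2(2) q \<alpha> v]) auto
    qed
  qed
  then show ?thesis by (rule that)
qed

text \<open>The distance is at most a constant times \<open>f\<close> at the height of
  \<open>s n\<close>, and a summable \<open>f\<close> tends to \<open>0\<close>.\<close>

lemma floyd_dist_null_of_bounded_distance:
  assumes g: "graph V E" "connected_graph V E" and f: "floyd_map f" and v: "v \<in> V"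
    and s: "range s \<subseteq> V" and t: "range t \<subseteq> V" and near: "\<And>n. graph_dist V E (t n) (s n) \<le> K"
    and esc: "filterlim (\<lambda>n. graph_dist V E v (s n)) at_top sequentially"
  shows "(\<lambda>n. floyd_dist V E f v (t n) (s n)) \<longlonglongrightarrow> 0"
proof -
  interpret Metric_space V "floyd_dist V E f v" by (rule Metric_space_floyd_dist[OF g f])
  obtain C where C: "C \<ge> 0" "\<And>x y. x \<in> V \<Longrightarrow> y \<in> V \<Longrightarrow> graph_dist V E x y \<le> K \<Longrightarrow>
      floyd_dist V E f v x y \<le> C * f (graph_dist V E v y)"
    by (rule floyd_dist_bounded_distance[OF g f v, of K]) blast
  have "f \<longlonglongrightarrow> 0" using f by (simp add: floyd_map_def summable_LIMSEQ_zero)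
  then have "(\<lambda>n. f (graph_dist V E v (s n))) \<longlonglongrightarrow> 0" using esc by (rule filterlim_compose)
  then have "(\<lambda>n. C * f (graph_dist V E v (s n))) \<longlonglongrightarrow> 0" by (rule tendsto_mult_right_zero)
  moreover have "floyd_dist V E f v (t n) (s n) \<le> C * f (graph_dist V E v (s n))" for n
    using s t near by (intro C(2)) auto
  ultimately show ?thesis by (intro Lim_null_comparison[where f = "\<lambda>n. floyd_dist V E f v (t n) (s n)"]) auto
qed

theorem corollary6p4:
  fixes V1 :: "'a set" and E1 :: "'a \<Rightarrow> 'a \<Rightarrow> bool"
    and V2 :: "'b set" and E2 :: "'b \<Rightarrow> 'b \<Rightarrow> bool"
    and f1 f2 :: "nat \<Rightarrow> real" and \<alpha> :: "nat \<Rightarrow> nat" and \<pi> :: "'b \<Rightarrow> 'a"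
    and v1 :: 'a and v2 :: 'b
  assumes "graph V1 E1" "locally_finite V1 E1" "connected_graph V1 E1"
    and "graph V2 E2" "locally_finite V2 E2" "connected_graph V2 E2"
    and "floyd_map f1" "floyd_map f2"
    and "distortion_map \<alpha>"
    and "quasi_isometry \<alpha> V2 (graph_dist V2 E2) V1 (graph_dist V1 E1) \<pi>"
    and "\<exists>D>0. \<forall>n. f2 n / f1 (\<alpha> n) \<le> D \<and> f1 n / f2 (\<alpha> n) \<le> D"
    and "v1 \<in> V1" "v2 \<in> V2"
  shows "\<exists>h. homeomorphic_map
               (Pi_functor (discrete_topology V1) (discrete_topology V2) \<pi>
                  (floyd_compactification V1 E1 f1 v1) (floyd_embed V1 E1 f1 v1))
               (floyd_compactification V2 E2 f2 v2) h \<and>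
             (\<forall>x\<in>V2. h (Inl x) = floyd_embed V2 E2 f2 v2 x)"
proof -
  note g1 = assms(1,3) and g2 = assms(4,6) and f1 = assms(7) and f2 = assms(8) and v = assms(12,13)
  have \<alpha>: "mono \<alpha>" using assms(9) by (simp add: distortion_map_def)
  obtain D where D: "\<And>n. f2 n / f1 (\<alpha> n) \<le> D" "\<And>n. f1 n / f2 (\<alpha> n) \<le> D"
    using assms(11) by blast
  obtain \<rho> where q: "quasi_isometric \<alpha> V2 (graph_dist V2 E2) V1 (graph_dist V1 E1) \<pi>"
    "quasi_isometric \<alpha> V1 (graph_dist V1 E1) V2 (graph_dist V2 E2) \<rho>"
    "quasi_inverse V2 (graph_dist V2 E2) V1 (graph_dist V1 E1) \<pi> \<rho>"
    using assms(10) by (auto simp: quasi_isometry_def)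
  have in1: "\<pi> x \<in> V1" if "x \<in> V2" for x using q(1) that by (auto simp: quasi_isometric_def)
  have in2: "\<rho> y \<in> V2" if "y \<in> V1" for y using q(2) that by (auto simp: quasi_isometric_def)
  obtain K2 K1 where K: "\<And>x. x \<in> V2 \<Longrightarrow> graph_dist V2 E2 (\<rho> (\<pi> x)) x \<le> K2"
    "\<And>y. y \<in> V1 \<Longrightarrow> graph_dist V1 E1 (\<pi> (\<rho> y)) y \<le> K1"
    using q(3) unfolding quasi_inverse_def by blast
  \<comment> \<open>Each growth condition serves one map: the bound on
    \<open>f1 n / f2 (\<alpha> n)\<close> makes \<pi> Lipschitz, the other one \<rho>.\<close>
  obtain C2 where P: "height_map V2 (floyd_dist V2 E2 f2 v2) (graph_dist V2 E2 v2)
      V1 (floyd_dist V1 E1 f1 v1) (graph_dist V1 E1 v1) \<pi> C2"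
    using height_map_quasi_isometric[OF g1 g2 f1 f2 \<alpha> q(1) D(2) v] .
  obtain C1 where R: "height_map V1 (floyd_dist V1 E1 f1 v1) (graph_dist V1 E1 v1)
      V2 (floyd_dist V2 E2 f2 v2) (graph_dist V2 E2 v2) \<rho> C1"
    using height_map_quasi_isometric[OF g2 g1 f2 f1 \<alpha> q(2) D(1) v(2,1)] .
  have "coarse_inverse V1 (floyd_dist V1 E1 f1 v1) (graph_dist V1 E1 v1)
      V2 (floyd_dist V2 E2 f2 v2) (graph_dist V2 E2 v2) \<pi> C2 \<rho> C1"
  proof (intro coarse_inverse.intro coarse_inverse_axioms.intro P R)
    fix s :: "nat \<Rightarrow> 'b" assume s: "range s \<subseteq> V2"
    show "(\<lambda>n. floyd_dist V2 E2 f2 v2 (\<rho> (\<pi> (s n))) (s n)) \<longlonglongrightarrow> 0"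
      if "filterlim (\<lambda>n. graph_dist V2 E2 v2 (s n)) at_top sequentially"
      using s in1 in2 K(1) by (intro floyd_dist_null_of_bounded_distance[OF g2 f2 v(2) s _ _ that, of _ K2]) auto
    assume lim: "filterlim (\<lambda>n. graph_dist V1 E1 v1 (\<pi> (s n))) at_top sequentially"
    show "filterlim (\<lambda>n. graph_dist V2 E2 v2 (s n)) at_top sequentially"
    proof (rule filterlim_at_top_nat_reflect[OF _ _ lim])
      \<comment> \<open>Reflection of escape rests on the first base point estimate, whereas
        \<open>proper\<close> rests on the second.\<close>
      show "mono (\<lambda>n. graph_dist V1 E1 v1 (\<pi> v2) + \<alpha> n)" using \<alpha> by (auto simp: mono_def)
      show "graph_dist V1 E1 v1 (\<pi> (s n)) \<le> graph_dist V1 E1 v1 (\<pi> v2) + \<alpha> (graph_dist V2 E2 v2 (s n))" for n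
        using s by (intro quasi_isometric_base_points(1)[OF g1(2) g2(2) q(1) \<alpha> v]) auto
    qed
  next
    fix t :: "nat \<Rightarrow> 'a" assume t: "range t \<subseteq> V1"
      and lim: "filterlim (\<lambda>n. graph_dist V1 E1 v1 (t n)) at_top sequentially"
    show "(\<lambda>n. floyd_dist V1 E1 f1 v1 (\<pi> (\<rho> (t n))) (t n)) \<longlonglongrightarrow> 0"
      using t in1 in2 K(2) by (intro floyd_dist_null_of_bounded_distance[OF g1 f1 v(1) t _ _ lim, of _ K1]) auto
  qed
  then interpret coarse_inverse V1 "floyd_dist V1 E1 f1 v1" "graph_dist V1 E1 v1"
    V2 "floyd_dist V2 E2 f2 v2" "graph_dist V2 E2 v2" \<pi> C2 \<rho> C1 .
  have "homeomorphic_map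
      (Pi_functor (discrete_topology V1) (discrete_topology V2) \<pi>
        (floyd_compactification V1 E1 f1 v1) (floyd_embed V1 E1 f1 v1))
      (floyd_compactification V2 E2 f2 v2) (case_sum (floyd_embed V2 E2 f2 v2) R.extend)"
    using floyd_embed_open_embedding[OF g1 f1, of v1] floyd_embed_open_embedding[OF g2 f2, of v2]
    unfolding floyd_compactification_def floyd_embed_def
    by (intro homeomorphic_map_Pi_functor) auto
  then show ?thesis by (intro exI conjI) auto
qed

end
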